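(* Let $n\ge 2$ and let $u_k$ $(k\in\mathbb{N})$ and $u_0$ be functions in $BV(\mathbb{R}^n)$. If $u_k\to u_0$ strongly in $L^1_{loc}(\mathbb{R}^n)$ and the sequence $|Du_k|(\mathbb{R}^n)$ is bounded, then $$\mathcal{E}_{\mathbb{R}^n}(u_0)\le\liminf_{k\to\infty}\mathcal{E}_{\mathbb{R}^n}(u_k).$$
   Context: $BV(\mathbb{R}^n)$ is the space of functions $u\in L^1(\mathbb{R}^n)$ with finite total variation $|Du|(\mathbb{R}^n)$; $\sigma_u$ is the Radon-Nikodym derivative of $Du$ with respect to $|Du|$. The affine $BV$ energy is $$\mathcal{E}_{\mathbb{R}^n}(u)=\alpha_n\left(\int_{\mathbb{S}^{n-1}}\left(\int_{\mathbb{R}^n}|\sigma_u(x)\cdot\xi|\,d(|Du|)(x)\right)^{-n}d\xi\right)^{-1/n},\qquad \alpha_n=(2\omega_{n-1})^{-1}(n\omega_n)^{1+1/n},$$ where $\omega_k$ is the volume of the unit ball in $\mathbb{R}^k$ and $d\xi$ is surface measure on the unit sphere $\mathbb{S}^{n-1}$; conventions: $0^{-n}=+\infty$, and the energy is $0$ if the outer integral is $+\infty$. *)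

theory Defs
  imports "HOL-Analysis.Analysis"
begin

definition vector_measure :: "('a::topological_space set \<Rightarrow> 'v::real_normed_vector) \<Rightarrow> bool" where
  "vector_measure \<nu> \<longleftrightarrow>
     (\<forall>A :: nat \<Rightarrow> 'a set. range A \<subseteq> sets borel \<longrightarrow> disjoint_family A \<longrightarrow>
        (\<lambda>i. \<nu> (A i)) sums \<nu> (\<Union>i. A i))"

definition variation :: "('a::topological_space set \<Rightarrow> 'v::real_normed_vector) \<Rightarrow> 'a set \<Rightarrow> ennreal" where
  "variation \<nu> E =
     (SUP A \<in> {A :: nat \<Rightarrow> 'a set. range A \<subseteq> sets borel \<and> disjoint_family A \<and> (\<Union>i. A i) = E}.
        \<Sum>i. ennreal (norm (\<nu> (A i))))"

text \<open>For a vector measure the set function above is countably additive, so the following is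
  a genuine Borel measure with these values.\<close>

definition variation_measure :: "('a::topological_space set \<Rightarrow> 'v::real_normed_vector) \<Rightarrow> 'a measure" where
  "variation_measure \<nu> = measure_of UNIV (sets borel) (variation \<nu>)"

text \<open>The Radon-Nikodym derivative of a vector measure with respect to its total variation;
  it is determined up to null sets of the total variation. The function \<open>RN_deriv\<close> of the library
  only covers nonnegative measures.\<close>

definition polar_density :: "('a::topological_space set \<Rightarrow> 'v::euclidean_space) \<Rightarrow> 'a \<Rightarrow> 'v" where
  "polar_density \<nu> =
     (SOME \<sigma>. \<sigma> \<in> borel_measurable borel \<and> integrable (variation_measure \<nu>) \<sigma> \<and>
        (\<forall>E \<in> sets borel. \<nu> E = (LINT x:E|variation_measure \<nu>. \<sigma> x)))"

text \<open>The integral of a vector field against a vector measure, \<open>\<integral> \<phi> \<bullet> d\<nu>\<close>.\<close>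

definition vector_measure_integral ::
    "('a::topological_space set \<Rightarrow> 'v::euclidean_space) \<Rightarrow> ('a \<Rightarrow> 'v) \<Rightarrow> real" where
  "vector_measure_integral \<nu> \<phi> = (LINT x|variation_measure \<nu>. \<phi> x \<bullet> polar_density \<nu> x)"

definition C1_compact_support :: "('a::euclidean_space \<Rightarrow> 'a) set" where
  "C1_compact_support =
     {\<phi>. (\<forall>x. \<phi> differentiable (at x)) \<and>
         (\<forall>h. continuous_on UNIV (\<lambda>x. frechet_derivative \<phi> (at x) h)) \<and>
         compact (closure {x. \<phi> x \<noteq> 0})}"

definition divergence :: "('a::euclidean_space \<Rightarrow> 'a) \<Rightarrow> 'a \<Rightarrow> real" where
  "divergence \<phi> x = (\<Sum>b\<in>Basis. frechet_derivative \<phi> (at x) b \<bullet> b)"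

definition is_gradient_measure :: "('a::euclidean_space \<Rightarrow> real) \<Rightarrow> ('a set \<Rightarrow> 'a) \<Rightarrow> bool" where
  "is_gradient_measure u \<nu> \<longleftrightarrow>
     vector_measure \<nu> \<and> emeasure (variation_measure \<nu>) UNIV < \<infinity> \<and>
     (\<forall>\<phi> \<in> C1_compact_support.
        (LINT x|lebesgue. u x * divergence \<phi> x) = - vector_measure_integral \<nu> \<phi>)"

text \<open>BV functions: integrable functions whose distributional gradient is a vector measure of
  finite total variation. By the Riesz representation theorem this is the same as finiteness of
  the supremum of \<open>\<integral> u div \<phi>\<close> over test fields \<open>\<phi>\<close> bounded by 1.\<close>

definition BV :: "('a::euclidean_space \<Rightarrow> real) set" where
  "BV = {u. integrable lebesgue u \<and> (\<exists>\<nu>. is_gradient_measure u \<nu>)}"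

text \<open>The values of the gradient measure on Borel sets are uniquely determined by \<open>u\<close>; the
  choice concerns only the irrelevant values on other sets.\<close>

definition grad :: "('a::euclidean_space \<Rightarrow> real) \<Rightarrow> 'a set \<Rightarrow> 'a" where
  "grad u = (SOME \<nu>. is_gradient_measure u \<nu>)"

definition total_variation :: "('a::euclidean_space \<Rightarrow> real) \<Rightarrow> 'a measure" where
  "total_variation u = variation_measure (grad u)"

definition sigma_BV :: "('a::euclidean_space \<Rightarrow> real) \<Rightarrow> 'a \<Rightarrow> 'a" where
  "sigma_BV u = polar_density (grad u)"

text \<open>Surface measure on the unit sphere by polar coordinates: the area of a Borel set \<open>A\<close> is the
  dimension times the volume of the part of the unit ball lying in the cone over \<open>A\<close>. In the
  definition, \<open>sgn x\<close> is the radial projection \<open>x / norm x\<close>.\<close>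

definition sphere_measure :: "'a::euclidean_space measure" where
  "sphere_measure =
     scale_measure (of_nat DIM('a))
       (distr (restrict_space lborel (ball 0 1 - {0})) (restrict_space borel (sphere 0 1)) sgn)"

definition affine_const :: "nat \<Rightarrow> real" where
  "affine_const n =
     inverse (2 * unit_ball_vol (real n - 1)) * (real n * unit_ball_vol (real n)) powr (1 + 1 / real n)"

definition directional_variation :: "('a::euclidean_space \<Rightarrow> real) \<Rightarrow> 'a \<Rightarrow> ennreal" where
  "directional_variation u \<xi> = (\<integral>\<^sup>+ x. ennreal \<bar>sigma_BV u x \<bullet> \<xi>\<bar> \<partial>total_variation u)"

text \<open>In \<open>ennreal\<close> the inverse of 0 is \<open>\<infinity>\<close>, which is the convention for the inner power.\<close>

definition affine_BV_energy :: "('a::euclidean_space \<Rightarrow> real) \<Rightarrow> real" where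
  "affine_BV_energy u =
     (let I = \<integral>\<^sup>+ \<xi>. inverse (directional_variation u \<xi> ^ DIM('a)) \<partial>sphere_measure
      in if I = \<infinity> then 0
         else affine_const DIM('a) * enn2real I powr (- 1 / real DIM('a)))"

end

theory Submission
  imports Defs
begin

text \<open>
  Write \<open>D_u(\<xi>) = \<integral> |\<sigma>_u \<bullet> \<xi>| d|Du|\<close> for the directional variation of \<open>u\<close>. As a function of \<open>\<xi>\<close> it is a
  seminorm with Lipschitz constant \<open>|Du|(\<real>\<^sup>n)\<close>, and the energy is an increasing, positively
  homogeneous function of it (\<open>affine_BV_energy_mono\<close>). It therefore suffices that for every \<open>a < 1\<close> the
  bound \<open>D_{u_k} \<ge> a D_{u_0}\<close> holds on the whole sphere for large \<open>k\<close>.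

  For a fixed direction, \<open>D_u(\<xi>)\<close> is the supremum of \<open>-\<integral> u (\<nabla>f \<bullet> \<xi>) dx\<close> over compactly supported
  continuously differentiable \<open>f\<close> with \<open>|f| \<le> 1\<close> (\<open>integral_abs_approx_C1\<close>). Each of these functionals is
  continuous for local \<open>L\<^sup>1\<close> convergence, so \<open>D_u(\<xi>)\<close> is lower semicontinuous
  (\<open>dir_var_lower_semicontinuous\<close>). The bound on the total variations makes the functions \<open>D_{u_k}\<close>
  equi-Lipschitz, and compactness of the sphere gives \<open>D_{u_k} \<ge> D_{u_0} - \<epsilon>\<close> uniformly for large \<open>k\<close>
  (\<open>dir_var_uniformly_lower_semicontinuous\<close>).

  To replace the additive error by a factor, \<open>D_{u_0}\<close> must have a positive minimum on the sphere. If
  \<open>D_{u_0}\<close> vanishes at some \<open>\<xi>\<^sub>0\<close>, then \<open>D_{u_0}(\<xi>) \<le> C |\<xi> - \<xi>\<^sub>0|\<close>, and \<open>|\<xi> - \<xi>\<^sub>0|\<^sup>-\<^sup>n\<close> is not integrable on a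
  sphere of dimension \<open>n - 1\<close> (\<open>sphere_energy_degenerate\<close>); the energy of \<open>u_0\<close> is then 0 by
  convention and the inequality is trivial.

  The measure-theoretic groundwork is that the total variation of a vector measure is a measure
  (\<open>emeasure_variation_measure\<close>) and that the polar decomposition exists (\<open>polar_density_properties\<close>).
\<close>

section \<open>The total variation of a vector measure\<close>

lemma vector_measure_sums:
  assumes "vector_measure \<nu>" "range A \<subseteq> sets borel" "disjoint_family A"
  shows "(\<lambda>i. \<nu> (A i)) sums \<nu> (\<Union>i. A i)"
  using assms by (auto simp: vector_measure_def)

lemma vector_measure_empty:
  assumes "vector_measure \<nu>"
  shows "\<nu> {} = 0"
proof -
  have "(\<lambda>i::nat. \<nu> {}) sums \<nu> (\<Union>i::nat. {})"
    by (rule vector_measure_sums[OF assms]) (auto simp: disjoint_family_on_def)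
  then show ?thesis
    using sums_summable summable_const_iff by blast
qed

lemma vector_measure_norm_UN_le:
  fixes \<nu> :: "'a::topological_space set \<Rightarrow> 'v::euclidean_space"
  assumes "vector_measure \<nu>" "range A \<subseteq> sets borel" "disjoint_family A"
  shows "ennreal (norm (\<nu> (\<Union>i. A i))) \<le> (\<Sum>i. ennreal (norm (\<nu> (A i))))"
proof (cases "(\<Sum>i. ennreal (norm (\<nu> (A i)))) = top")
  case False
  then have s: "summable (\<lambda>i. norm (\<nu> (A i)))"
    by (intro summable_suminf_not_top) auto
  have "norm (\<nu> (\<Union>i. A i)) \<le> (\<Sum>i. norm (\<nu> (A i)))"
    using summable_norm[OF s] sums_unique[OF vector_measure_sums[OF assms]] by simp
  then show ?thesis
    using False by (simp add: ennreal_leI)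
qed simp

lemma variation_ge_suminf:
  assumes "range A \<subseteq> sets borel" "disjoint_family A" "(\<Union>i. A i) = E"
  shows "(\<Sum>i. ennreal (norm (\<nu> (A i)))) \<le> variation \<nu> E"
  unfolding variation_def using assms by (intro SUP_upper) auto

lemma norm_le_variation:
  assumes "E \<in> sets borel"
  shows "ennreal (norm (\<nu> E)) \<le> variation \<nu> E"
proof -
  let ?A = "\<lambda>i::nat. if i = 0 then E else {}"
  have "ennreal (norm (\<nu> E)) = (\<Sum>i\<in>{0}. ennreal (norm (\<nu> (?A i))))"
    by simp
  also have "\<dots> \<le> (\<Sum>i. ennreal (norm (\<nu> (?A i))))"
    by (rule sum_le_suminf) auto
  also have "\<dots> \<le> variation \<nu> E"
    using assms by (intro variation_ge_suminf) (auto simp: disjoint_family_on_def split: if_splits)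
  finally show ?thesis .
qed

lemma variation_Un_ge:
  fixes \<nu> :: "'a::topological_space set \<Rightarrow> 'v::euclidean_space"
  assumes \<nu>: "vector_measure \<nu>" and EF: "E \<in> sets borel" "F \<in> sets borel" and "E \<inter> F = {}"
  shows "variation \<nu> E + variation \<nu> F \<le> variation \<nu> (E \<union> F)"
proof -
  define P where "P G = {A :: nat \<Rightarrow> 'a set. range A \<subseteq> sets borel \<and> disjoint_family A \<and> (\<Union>i. A i) = G}" for G :: "'a set"
  define S where "S A = (\<Sum>i. ennreal (norm (\<nu> (A i))))" for A :: "nat \<Rightarrow> 'a set"
  have var: "variation \<nu> G = (SUP A\<in>P G. S A)" for G
    by (simp add: variation_def P_def S_def)
  have le: "S a + S b \<le> variation \<nu> (E \<union> F)" if "a \<in> P E" "b \<in> P F" for a b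
  proof -
    \<comment> \<open>The two partitions as the rows 0 and 1 of an array with empty further rows, which is then
      enumerated by \<open>prod_decode\<close>.\<close>
    define D where "D = (\<lambda>(m::nat, k). if m = 0 then a k else if m = 1 then b k else {})"
    have "S a + S b = (\<Sum>m\<in>{0,1}. \<Sum>k. ennreal (norm (\<nu> (D (m, k)))))"
      by (simp add: D_def S_def)
    also have "\<dots> = (\<Sum>m. \<Sum>k. ennreal (norm (\<nu> (D (m, k)))))"
      by (rule suminf_finite[symmetric]) (auto simp: D_def vector_measure_empty[OF \<nu>])
    also have "\<dots> = (\<Sum>i. ennreal (norm (\<nu> (D (prod_decode i)))))"
      by (rule suminf_ennreal_2dimen[symmetric]) simp
    also have "\<dots> \<le> variation \<nu> (E \<union> F)"
    proof (rule variation_ge_suminf)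
      show "range (\<lambda>i. D (prod_decode i)) \<subseteq> sets borel"
        using that by (auto simp: D_def P_def split: prod.splits)
      have a: "a k \<subseteq> E" "k \<noteq> l \<Longrightarrow> a k \<inter> a l = {}" and b: "b k \<subseteq> F" "k \<noteq> l \<Longrightarrow> b k \<inter> b l = {}" for k l
        using that by (auto simp: P_def disjoint_family_on_def)
      define G where "G m = (if m = 0 then E else if m = 1 then F else {})" for m :: nat
      have G: "D (m, k) \<subseteq> G m" for m k
        using a(1) b(1) by (simp add: D_def G_def)
      have G_disj: "G m \<inter> G m' = {}" if "m \<noteq> m'" for m m'
        using that \<open>E \<inter> F = {}\<close> by (simp add: G_def Int_commute)
      have "D (m, k) \<inter> D (m', k') = {}" if "(m, k) \<noteq> (m', k')" for m k m' k'
      proof (cases "m = m'")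
        case True
        then show ?thesis
          using that a(2) b(2) by (simp add: D_def)
      next
        case False
        then show ?thesis
          using G[of m k] G[of m' k'] G_disj[of m m'] by blast
      qed
      then have "D p \<inter> D q = {}" if "p \<noteq> q" for p q
        using that by (cases p; cases q) blast
      then show "disjoint_family (\<lambda>i. D (prod_decode i))"
        by (simp add: disjoint_family_on_def inj_eq[OF inj_prod_decode])
      have "(\<Union>i. D (prod_decode i)) = (\<Union>p. D p)"
        using image_image[of D prod_decode UNIV] by (simp add: surj_prod_decode)
      also have "\<dots> = E \<union> F"
      proof -
        have "a k \<subseteq> (\<Union>p. D p)" "b k \<subseteq> (\<Union>p. D p)" for k
          using UN_upper[of "(0, k)" UNIV D] UN_upper[of "(1, k)" UNIV D] unfolding D_def by simp_all
        moreover have "E = (\<Union>k. a k)" "F = (\<Union>k. b k)"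
          using that by (simp_all add: P_def)
        ultimately have "E \<union> F \<subseteq> (\<Union>p. D p)"
          by (simp only:) (intro Un_least UN_least)
        moreover have "D (m, k) \<subseteq> E \<union> F" for m k
          using a(1)[of k] b(1)[of k] by (auto simp: D_def)
        then have "(\<Union>p. D p) \<subseteq> E \<union> F"
          by (intro UN_least) (simp add: split_paired_all)
        ultimately show ?thesis
          by (intro subset_antisym)
      qed
      finally show "(\<Union>i. D (prod_decode i)) = E \<union> F" .
    qed
    finally show ?thesis .
  qed
  have ne: "P G \<noteq> {}" if "G \<in> sets borel" for G
    using that
    by (auto simp: P_def disjoint_family_on_def intro!: exI[of _ "\<lambda>i::nat. if i = 0 then G else {}"] split: if_splits)
  have "variation \<nu> E + variation \<nu> F = (SUP a\<in>P E. SUP b\<in>P F. S a + S b)"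
    unfolding var by (subst ennreal_SUP_add_left[symmetric]) (simp_all add: ne EF ennreal_SUP_add_right)
  also have "\<dots> \<le> variation \<nu> (E \<union> F)"
    by (intro SUP_least le)
  finally show ?thesis .
qed

lemma variation_mono:
  fixes \<nu> :: "'a::topological_space set \<Rightarrow> 'v::euclidean_space"
  assumes "vector_measure \<nu>" "E \<in> sets borel" "F \<in> sets borel" "E \<subseteq> F"
  shows "variation \<nu> E \<le> variation \<nu> F"
proof -
  have "variation \<nu> E \<le> variation \<nu> E + variation \<nu> (F - E)"
    by simp
  also have "\<dots> \<le> variation \<nu> (E \<union> (F - E))"
    using assms by (intro variation_Un_ge) auto
  finally show ?thesis
    using assms(4) by (simp add: Un_absorb1)
qed

lemma variation_UN_le:
  fixes \<nu> :: "'a::topological_space set \<Rightarrow> 'v::euclidean_space"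
  assumes \<nu>: "vector_measure \<nu>" and E: "range E \<subseteq> sets borel" "disjoint_family E"
  shows "variation \<nu> (\<Union>i. E i) \<le> (\<Sum>i::nat. variation \<nu> (E i))"
  unfolding variation_def[of \<nu> "\<Union>i. E i"]
proof (rule SUP_least, clarify)
  fix A :: "nat \<Rightarrow> 'a set"
  assume A: "range A \<subseteq> sets borel" "disjoint_family A" "(\<Union>i. A i) = (\<Union>i. E i)"
  have "ennreal (norm (\<nu> (A j))) \<le> (\<Sum>i. ennreal (norm (\<nu> (A j \<inter> E i))))" for j
  proof -
    have "(\<Union>i. A j \<inter> E i) = A j \<inter> (\<Union>i. A i)"
      unfolding A(3) by (rule Int_UN_distrib[symmetric])
    also have "\<dots> = A j"
      by blast
    finally have eq: "(\<Union>i. A j \<inter> E i) = A j" .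
    have "range (\<lambda>i. A j \<inter> E i) \<subseteq> sets borel"
      using A(1) E(1) by (auto simp: image_subset_iff)
    moreover have "disjoint_family (\<lambda>i. A j \<inter> E i)"
      using E(2) by (rule disjoint_family_subset) auto
    ultimately have "ennreal (norm (\<nu> (\<Union>i. A j \<inter> E i))) \<le> (\<Sum>i. ennreal (norm (\<nu> (A j \<inter> E i))))"
      by (rule vector_measure_norm_UN_le[OF \<nu>])
    then show ?thesis
      unfolding eq .
  qed
  then have "(\<Sum>j. ennreal (norm (\<nu> (A j)))) \<le> (\<Sum>j. \<Sum>i. ennreal (norm (\<nu> (A j \<inter> E i))))"
    by (rule suminf_le) (rule summableI)+
  also have "\<dots> = (\<Sum>i. \<Sum>j. ennreal (norm (\<nu> (A j \<inter> E i))))"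
  proof -
    have "(\<integral>\<^sup>+j. (\<Sum>i. ennreal (norm (\<nu> (A j \<inter> E i)))) \<partial>count_space UNIV) =
        (\<Sum>i. \<integral>\<^sup>+j. ennreal (norm (\<nu> (A j \<inter> E i))) \<partial>count_space UNIV)"
      by (rule nn_integral_suminf) simp
    then show ?thesis
      unfolding nn_integral_count_space_nat .
  qed
  also have "\<dots> \<le> (\<Sum>i. variation \<nu> (E i))"
  proof (intro suminf_le variation_ge_suminf)
    show "(\<Union>j. A j \<inter> E i) = E i" for i
    proof -
      have "(\<Union>j. A j \<inter> E i) = (\<Union>j. E j) \<inter> E i"
        unfolding A(3)[symmetric] by simp
      also have "\<dots> = E i"
        by blast
      finally show ?thesis .
    qed
    show "range (\<lambda>j. A j \<inter> E i) \<subseteq> sets borel" for i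
      using A(1) E(1) by (auto simp: image_subset_iff)
    show "disjoint_family (\<lambda>j. A j \<inter> E i)" for i
      using A(2) by (rule disjoint_family_subset) auto
  qed auto
  finally show "(\<Sum>j. ennreal (norm (\<nu> (A j)))) \<le> (\<Sum>i. variation \<nu> (E i))" .
qed

lemma variation_UN_ge:
  fixes \<nu> :: "'a::topological_space set \<Rightarrow> 'v::euclidean_space"
  assumes \<nu>: "vector_measure \<nu>" and E: "range E \<subseteq> sets borel" "disjoint_family E"
  shows "(\<Sum>i::nat. variation \<nu> (E i)) \<le> variation \<nu> (\<Union>i. E i)"
proof (rule suminf_le_const)
  fix N
  have "(\<Sum>i<N. variation \<nu> (E i)) \<le> variation \<nu> (\<Union>i<N. E i)"
  proof (induction N)
    case (Suc N)
    have "(\<Sum>i<Suc N. variation \<nu> (E i)) \<le> variation \<nu> (\<Union>i<N. E i) + variation \<nu> (E N)"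
      using Suc by (auto intro: add_right_mono)
    also have "\<dots> \<le> variation \<nu> ((\<Union>i<N. E i) \<union> E N)"
    proof (rule variation_Un_ge[OF \<nu>])
      show "(\<Union>i<N. E i) \<inter> E N = {}"
      proof -
        have "E i \<inter> E N = {}" if "i < N" for i
          using E(2) that by (simp add: disjoint_family_on_def)
        then show ?thesis by blast
      qed
    qed (use E(1) in auto)
    also have "(\<Union>i<N. E i) \<union> E N = (\<Union>i<Suc N. E i)"
      by (auto simp: less_Suc_eq)
    finally show ?case .
  qed simp
  also have "\<dots> \<le> variation \<nu> (\<Union>i. E i)"
    using E(1) by (intro variation_mono[OF \<nu>]) auto
  finally show "(\<Sum>i<N. variation \<nu> (E i)) \<le> variation \<nu> (\<Union>i. E i)" .
qed simp

text \<open>A set function that is not countably additive is turned into the zero measure by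
  \<^const>\<open>measure_of\<close>. Here superadditivity comes from concatenating partitions of the pieces, and
  subadditivity from intersecting a partition of the union with the pieces.\<close>

lemma emeasure_variation_measure:
  fixes \<nu> :: "'a::topological_space set \<Rightarrow> 'v::euclidean_space"
  assumes \<nu>: "vector_measure \<nu>" and "E \<in> sets borel"
  shows "emeasure (variation_measure \<nu>) E = variation \<nu> E"
  unfolding variation_measure_def
proof (rule emeasure_measure_of_sigma)
  show "sigma_algebra UNIV (sets (borel :: 'a measure))"
    by (metis sets.sigma_algebra_axioms space_borel)
  have "variation \<nu> {} \<le> 0"
    unfolding variation_def
    by (rule SUP_least) (auto simp: vector_measure_empty[OF \<nu>])
  then show "positive (sets borel) (variation \<nu>)"
    by (simp add: positive_def)
  show "countably_additive (sets borel) (variation \<nu>)"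
    by (intro countably_additiveI antisym variation_UN_le[OF \<nu>] variation_UN_ge[OF \<nu>])
qed (use assms in auto)

lemma sets_variation_measure [simp, measurable_cong]: "sets (variation_measure \<nu>) = sets borel"
  using sets.sets_measure_of_eq[of borel "variation \<nu>"] by (simp add: variation_measure_def)

lemma space_variation_measure [simp]: "space (variation_measure \<nu>) = UNIV"
  unfolding variation_measure_def by (simp add: space_measure_of_conv)

section \<open>Polar decomposition\<close>

text \<open>The scalar measure \<open>\<nu> \<bullet> b\<close> is signed, so the Radon-Nikodym theorem is applied to
  \<open>\<nu> \<bullet> b + |\<nu>|\<close>, which is nonnegative because \<open>|\<nu> E \<bullet> b| \<le> |\<nu>| E\<close> for a unit vector \<open>b\<close>; the density of
  \<open>|\<nu>|\<close> itself is then subtracted.\<close>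

lemma component_density_exists:
  fixes \<nu> :: "'a::topological_space set \<Rightarrow> 'v::euclidean_space"
  assumes \<nu>: "vector_measure \<nu>" and fin: "emeasure (variation_measure \<nu>) UNIV < \<infinity>" and b: "norm b = 1"
  shows "\<exists>s \<in> borel_measurable borel. integrable (variation_measure \<nu>) s \<and>
           (\<forall>E\<in>sets borel. \<nu> E \<bullet> b = (LINT x:E|variation_measure \<nu>. s x))"
proof -
  let ?\<mu> = "variation_measure \<nu>"
  interpret \<mu>: finite_measure ?\<mu>
    using fin by (intro finite_measureI) auto
  have abs_le: "\<bar>\<nu> E \<bullet> b\<bar> \<le> measure ?\<mu> E" if "E \<in> sets borel" for E
  proof -
    have "ennreal (norm (\<nu> E)) \<le> ennreal (measure ?\<mu> E)"
      using norm_le_variation[OF that, of \<nu>] emeasure_variation_measure[OF \<nu> that] \<mu>.emeasure_eq_measure[of E]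
      by simp
    then have "norm (\<nu> E) \<le> measure ?\<mu> E"
      by simp
    then show ?thesis
      using Cauchy_Schwarz_ineq2[of "\<nu> E" b] b by simp
  qed
  then have nonneg: "0 \<le> \<nu> E \<bullet> b + measure ?\<mu> E" if "E \<in> sets borel" for E
    using that by (fastforce simp: abs_le_iff)
  define N where "N = measure_of UNIV (sets borel) (\<lambda>E. ennreal (\<nu> E \<bullet> b + measure ?\<mu> E))"
  have sets_N: "sets N = sets borel"
    using sets.sets_measure_of_eq[of borel] by (simp add: N_def)
  have N: "emeasure N E = ennreal (\<nu> E \<bullet> b + measure ?\<mu> E)" if "E \<in> sets borel" for E
    unfolding N_def
  proof (rule emeasure_measure_of_sigma)
    show "sigma_algebra UNIV (sets (borel :: 'a measure))"
      by (metis sets.sigma_algebra_axioms space_borel)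
    show "positive (sets borel) (\<lambda>E. ennreal (\<nu> E \<bullet> b + measure ?\<mu> E))"
      by (simp add: positive_def vector_measure_empty[OF \<nu>])
    show "countably_additive (sets borel) (\<lambda>E. ennreal (\<nu> E \<bullet> b + measure ?\<mu> E))"
    proof (rule countably_additiveI)
      fix A :: "nat \<Rightarrow> 'a set"
      assume A: "range A \<subseteq> sets borel" "disjoint_family A"
      have "(\<lambda>i. \<nu> (A i) \<bullet> b) sums (\<nu> (\<Union>i. A i) \<bullet> b)"
        by (rule bounded_linear.sums[OF bounded_linear_inner_left vector_measure_sums[OF \<nu> A]])
      moreover have "(\<lambda>i. measure ?\<mu> (A i)) sums measure ?\<mu> (\<Union>i. A i)"
        using A by (intro \<mu>.finite_measure_UNION) auto
      ultimately have "(\<lambda>i. \<nu> (A i) \<bullet> b + measure ?\<mu> (A i)) sums (\<nu> (\<Union>i. A i) \<bullet> b + measure ?\<mu> (\<Union>i. A i))"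
        by (rule sums_add)
      then show "(\<Sum>i. ennreal (\<nu> (A i) \<bullet> b + measure ?\<mu> (A i))) =
          ennreal (\<nu> (\<Union>i. A i) \<bullet> b + measure ?\<mu> (\<Union>i. A i))"
        using A by (intro suminf_ennreal_eq nonneg) auto
    qed
  qed (use that in auto)
  have "absolutely_continuous ?\<mu> N"
    unfolding absolutely_continuous_def
  proof
    fix E assume E: "E \<in> null_sets ?\<mu>"
    then have "E \<in> sets borel" "measure ?\<mu> E = 0"
      by (auto simp: null_sets_def measure_def)
    then show "E \<in> null_sets N"
      using abs_le[of E] by (auto simp: null_sets_def sets_N N)
  qed
  then obtain f where f: "f \<in> borel_measurable ?\<mu>" and dens: "density ?\<mu> f = N"
    using \<mu>.Radon_Nikodym[of N] by (auto simp: sets_N)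
  have f_E: "(\<integral>\<^sup>+x. f x * indicator E x \<partial>?\<mu>) = ennreal (\<nu> E \<bullet> b + measure ?\<mu> E)" if "E \<in> sets borel" for E
    using that f by (subst emeasure_density[symmetric]) (auto simp: dens N)
  have "(\<integral>\<^sup>+x. f x \<partial>?\<mu>) \<noteq> \<infinity>"
    using f_E[of UNIV] by simp
  then have fin_AE: "AE x in ?\<mu>. f x \<noteq> \<infinity>"
    by (rule nn_integral_PInf_AE[OF f])
  define h where "h x = enn2real (f x)" for x
  have h_meas: "h \<in> borel_measurable ?\<mu>"
    unfolding h_def using f by measurable
  have h_E: "has_bochner_integral ?\<mu> (\<lambda>x. indicator E x *\<^sub>R h x) (\<nu> E \<bullet> b + measure ?\<mu> E)"
    if E: "E \<in> sets borel" for E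
  proof (rule has_bochner_integral_nn_integral)
    show "(\<lambda>x. indicator E x *\<^sub>R h x) \<in> borel_measurable ?\<mu>"
      using h_meas E by (intro borel_measurable_scaleR borel_measurable_indicator) simp_all
    show "AE x in ?\<mu>. 0 \<le> indicator E x *\<^sub>R h x"
      by (simp add: h_def)
    show "0 \<le> \<nu> E \<bullet> b + measure ?\<mu> E"
      by (rule nonneg[OF E])
    have "(\<integral>\<^sup>+x. ennreal (indicator E x *\<^sub>R h x) \<partial>?\<mu>) = (\<integral>\<^sup>+x. f x * indicator E x \<partial>?\<mu>)"
    proof (rule nn_integral_cong_AE)
      show "AE x in ?\<mu>. ennreal (indicator E x *\<^sub>R h x) = f x * indicator E x"
        using fin_AE by eventually_elim (auto simp: h_def indicator_def less_top)
    qed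
    then show "(\<integral>\<^sup>+x. ennreal (indicator E x *\<^sub>R h x) \<partial>?\<mu>) = ennreal (\<nu> E \<bullet> b + measure ?\<mu> E)"
      using f_E[OF E] by simp
  qed
  have h_int: "integrable ?\<mu> h"
    using h_E[of UNIV] by (simp add: has_bochner_integral_iff)
  show ?thesis
  proof (intro bexI conjI ballI)
    show "(\<lambda>x. h x - 1) \<in> borel_measurable borel"
      using h_meas measurable_cong_sets[OF sets_variation_measure refl] by (intro borel_measurable_diff) auto
    show "integrable ?\<mu> (\<lambda>x. h x - 1)"
      using h_int by simp
    fix E :: "'a set" assume E: "E \<in> sets borel"
    have "integrable ?\<mu> (indicat_real E)"
      using E by (intro integrable_real_indicator) (auto simp: less_top[symmetric])
    then have "(LINT x:E|?\<mu>. h x - 1) = (LINT x:E|?\<mu>. h x) - (LINT x:E|?\<mu>. 1)"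
      using h_E[OF E] E
      by (intro set_integral_diff) (auto simp: set_integrable_def has_bochner_integral_iff)
    also have "(LINT x:E|?\<mu>. h x) = \<nu> E \<bullet> b + measure ?\<mu> E"
      using h_E[OF E] by (simp add: set_lebesgue_integral_def has_bochner_integral_iff)
    also have "(LINT x:E|?\<mu>. 1) = measure ?\<mu> E"
      using E by (simp add: set_lebesgue_integral_def)
    finally show "\<nu> E \<bullet> b = (LINT x:E|?\<mu>. h x - 1)"
      by simp
  qed
qed

lemma polar_density_properties:
  fixes \<nu> :: "'a::topological_space set \<Rightarrow> 'v::euclidean_space"
  assumes \<nu>: "vector_measure \<nu>" and fin: "emeasure (variation_measure \<nu>) UNIV < \<infinity>"
  shows "polar_density \<nu> \<in> borel_measurable borel"
    and "integrable (variation_measure \<nu>) (polar_density \<nu>)"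
    and "E \<in> sets borel \<Longrightarrow> \<nu> E = (LINT x:E|variation_measure \<nu>. polar_density \<nu> x)"
proof -
  let ?\<mu> = "variation_measure \<nu>"
  have "\<exists>s. \<forall>b\<in>Basis. s b \<in> borel_measurable borel \<and> integrable ?\<mu> (s b) \<and>
      (\<forall>E\<in>sets borel. \<nu> E \<bullet> b = (LINT x:E|?\<mu>. s b x))"
    using component_density_exists[OF \<nu> fin] by (intro bchoice) (metis norm_Basis)
  then obtain s where s: "\<And>b. b \<in> Basis \<Longrightarrow> s b \<in> borel_measurable borel"
      "\<And>b. b \<in> Basis \<Longrightarrow> integrable ?\<mu> (s b)"
      "\<And>b E. b \<in> Basis \<Longrightarrow> E \<in> sets borel \<Longrightarrow> \<nu> E \<bullet> b = (LINT x:E|?\<mu>. s b x)"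
    by blast
  define \<sigma> where "\<sigma> x = (\<Sum>b\<in>Basis. s b x *\<^sub>R b)" for x
  have meas: "\<sigma> \<in> borel_measurable borel"
    unfolding \<sigma>_def using s(1) by (intro borel_measurable_sum borel_measurable_scaleR) auto
  have int: "integrable ?\<mu> \<sigma>"
    unfolding \<sigma>_def using s(2) by (intro Bochner_Integration.integrable_sum integrable_scaleR_left) auto
  have eq: "\<nu> E = (LINT x:E|?\<mu>. \<sigma> x)" if E: "E \<in> sets borel" for E
  proof (rule euclidean_eqI)
    fix b :: 'v assume b: "b \<in> Basis"
    have "integrable ?\<mu> (\<lambda>x. indicator E x *\<^sub>R \<sigma> x)"
      using int E by (intro integrable_mult_indicator) auto
    then have "(LINT x:E|?\<mu>. \<sigma> x) \<bullet> b = (LINT x:E|?\<mu>. \<sigma> x \<bullet> b)"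
      unfolding set_lebesgue_integral_def by (subst integral_inner_left[symmetric]) auto
    also have "\<dots> = \<nu> E \<bullet> b"
      using s(3)[OF b E] b by (simp add: \<sigma>_def inner_sum_left_Basis)
    finally show "\<nu> E \<bullet> b = (LINT x:E|?\<mu>. \<sigma> x) \<bullet> b" ..
  qed
  have "polar_density \<nu> \<in> borel_measurable borel \<and> integrable ?\<mu> (polar_density \<nu>) \<and>
      (\<forall>E\<in>sets borel. \<nu> E = (LINT x:E|?\<mu>. polar_density \<nu> x))"
    unfolding polar_density_def by (rule someI[of _ \<sigma>]) (use meas int eq in blast)
  then show "polar_density \<nu> \<in> borel_measurable borel" "integrable ?\<mu> (polar_density \<nu>)"
    "E \<in> sets borel \<Longrightarrow> \<nu> E = (LINT x:E|?\<mu>. polar_density \<nu> x)"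
    by auto
qed

section \<open>Continuously differentiable cutoff functions\<close>

definition has_C1_gradient :: "('a::euclidean_space \<Rightarrow> real) \<Rightarrow> ('a \<Rightarrow> 'a) \<Rightarrow> bool" where
  "has_C1_gradient f g \<longleftrightarrow>
     (\<forall>x. (f has_derivative (\<lambda>h. g x \<bullet> h)) (at x)) \<and> continuous_on UNIV g"

lemma has_C1_gradient_continuous: "has_C1_gradient f g \<Longrightarrow> continuous_on UNIV f"
  by (auto simp: has_C1_gradient_def intro!: has_derivative_continuous continuous_at_imp_continuous_on)

lemma has_C1_gradient_sum:
  assumes "\<And>i. i \<in> I \<Longrightarrow> has_C1_gradient (f i) (g i)"
  shows "has_C1_gradient (\<lambda>x. \<Sum>i\<in>I. f i x) (\<lambda>x. \<Sum>i\<in>I. g i x)"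
  using assms unfolding has_C1_gradient_def inner_sum_left
  by (auto intro!: has_derivative_sum continuous_on_sum)

lemma has_C1_gradient_diff:
  assumes "has_C1_gradient f g" "has_C1_gradient f' g'"
  shows "has_C1_gradient (\<lambda>x. f x - f' x) (\<lambda>x. g x - g' x)"
  using assms unfolding has_C1_gradient_def inner_diff_left
  by (auto intro!: has_derivative_diff continuous_on_diff)

lemma has_C1_gradient_compose:
  assumes f: "has_C1_gradient f g"
    and p: "\<And>t. (p has_real_derivative p' t) (at t)" and p': "continuous_on UNIV p'"
  shows "has_C1_gradient (\<lambda>x. p (f x)) (\<lambda>x. p' (f x) *\<^sub>R g x)"
  unfolding has_C1_gradient_def
proof (intro conjI allI)
  fix x
  have "((\<lambda>x. p (f x)) has_derivative (\<lambda>h. (g x \<bullet> h) * p' (f x))) (at x)"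
    using f by (intro DERIV_compose_FDERIV[OF p]) (auto simp: has_C1_gradient_def)
  then show "((\<lambda>x. p (f x)) has_derivative (\<lambda>h. (p' (f x) *\<^sub>R g x) \<bullet> h)) (at x)"
    by (simp add: mult.commute)
  have "continuous_on UNIV (\<lambda>x. p' (f x))"
    by (rule continuous_on_compose2[OF p' has_C1_gradient_continuous[OF f]]) simp
  then show "continuous_on UNIV (\<lambda>x. p' (f x) *\<^sub>R g x)"
    using f by (auto simp: has_C1_gradient_def intro!: continuous_on_scaleR)
qed

lemma DERIV_pos_part_square: "((\<lambda>t::real. (max 0 t)\<^sup>2) has_real_derivative 2 * max 0 t) (at t)"
proof -
  consider "t > 0" | "t < 0" | "t = 0" by linarith
  then show ?thesis
  proof cases
    case 1
    have "((\<lambda>t::real. t\<^sup>2) has_real_derivative 2 * max 0 t) (at t)"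
      using 1 by (auto intro!: derivative_eq_intros)
    then show ?thesis
      by (rule has_field_derivative_transform_within_open[where S="{0<..}"]) (use 1 in auto)
  next
    case 2
    have "((\<lambda>t::real. 0) has_real_derivative 2 * max 0 t) (at t)"
      using 2 by auto
    then show ?thesis
      by (rule has_field_derivative_transform_within_open[where S="{..<0}"]) (use 2 in auto)
  next
    case 3
    have "((\<lambda>h::real. (max 0 h)\<^sup>2 / h) \<longlongrightarrow> 0) (at 0)"
    proof (rule Lim_null_comparison)
      show "\<forall>\<^sub>F h in at 0. norm ((max 0 h)\<^sup>2 / h) \<le> \<bar>h\<bar>"
        by (rule always_eventually) (auto simp: max_def power2_eq_square)
      show "((\<lambda>h::real. \<bar>h\<bar>) \<longlongrightarrow> 0) (at 0)"
        by (auto intro!: tendsto_eq_intros)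
    qed
    then show ?thesis
      using 3 by (simp add: DERIV_def)
  qed
qed

text \<open>Around each point of a compact set there is a ball inside the open set carrying the
  bump \<open>(max 0 (r\<^sup>2 - |x - c|\<^sup>2))\<^sup>2\<close>. A finite sum of bumps is bounded below on the compact set by
  some \<open>m > 0\<close>, and \<open>t \<mapsto> 1 - (max 0 (1 - t / m))\<^sup>2\<close> flattens it to the value 1 there.\<close>

lemma C1_Urysohn:
  fixes K U :: "'a::euclidean_space set"
  assumes K: "compact K" and U: "open U" and KU: "K \<subseteq> U"
  obtains f g where "has_C1_gradient f g" "\<And>x. 0 \<le> f x" "\<And>x. f x \<le> 1"
    "\<And>x. x \<in> K \<Longrightarrow> f x = 1" "\<And>x. x \<notin> U \<Longrightarrow> f x = 0" "bounded {x. f x \<noteq> 0}"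
proof -
  have "\<exists>r. \<forall>x\<in>K. 0 < r x \<and> cball x (r x) \<subseteq> U"
    using U KU by (intro bchoice) (meson open_contains_cball subsetD)
  then obtain r where r: "\<And>x. x \<in> K \<Longrightarrow> 0 < r x" "\<And>x. x \<in> K \<Longrightarrow> cball x (r x) \<subseteq> U"
    by blast
  have cover: "K \<subseteq> (\<Union>c\<in>K. ball c (r c))"
    using r(1) by force
  obtain D where D: "D \<subseteq> K" "finite D" "K \<subseteq> (\<Union>c\<in>D. ball c (r c))"
    by (rule compactE_image[OF K _ cover]) auto
  define q :: "real \<Rightarrow> real" where "q t = (max 0 t)\<^sup>2" for t
  have q: "(q has_real_derivative 2 * max 0 t) (at t)" for t
    using DERIV_pos_part_square[of t] by (simp add: q_def[abs_def])
  have q0: "q t = 0 \<longleftrightarrow> t \<le> 0" "0 \<le> q t" for t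
    by (auto simp: q_def max_def)
  define v where "v c x = (r c)\<^sup>2 - (x - c) \<bullet> (x - c)" for c x :: 'a
  have "has_C1_gradient (v c) (\<lambda>x. - 2 *\<^sub>R (x - c))" for c
    unfolding has_C1_gradient_def v_def
    by (auto intro!: derivative_eq_intros continuous_intros simp: inner_commute algebra_simps)
  then have bump: "has_C1_gradient (\<lambda>x. q (v c x)) (\<lambda>x. (2 * max 0 (v c x)) *\<^sub>R (- 2 *\<^sub>R (x - c)))" for c
    by (rule has_C1_gradient_compose[OF _ q]) (intro continuous_intros)
  define s where "s x = (\<Sum>c\<in>D. q (v c x))" for x
  define gs where "gs x = (\<Sum>c\<in>D. (2 * max 0 (v c x)) *\<^sub>R (- 2 *\<^sub>R (x - c)))" for x
  have gs: "has_C1_gradient s gs"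
    unfolding s_def[abs_def] gs_def[abs_def] by (rule has_C1_gradient_sum) (rule bump)
  have s0: "0 \<le> s x" for x
    by (auto simp: s_def q0 intro!: sum_nonneg)
  have v_pos: "0 < v c x \<longleftrightarrow> dist c x < r c" if "c \<in> D" for c x
  proof -
    have "0 < v c x \<longleftrightarrow> (norm (x - c))\<^sup>2 < (r c)\<^sup>2"
      by (simp add: v_def dot_square_norm)
    also have "\<dots> \<longleftrightarrow> norm (x - c) < r c"
      using r(1)[of c] that D(1) by (metis norm_ge_zero less_le_not_le power2_less_imp_less power_strict_mono pos2 subsetD)
    finally show ?thesis
      by (simp add: dist_norm norm_minus_commute)
  qed
  have s_pos: "0 < s x" if "x \<in> K" for x
  proof -
    obtain c where c: "c \<in> D" "dist c x < r c"
      using D(3) \<open>x \<in> K\<close> by fastforce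
    then have "0 < q (v c x)"
      using v_pos[of c x] q0[of "v c x"] by linarith
    moreover have "q (v c x) \<le> s x"
      unfolding s_def using c(1) D(2) q0(2) by (intro member_le_sum) auto
    ultimately show ?thesis by linarith
  qed
  obtain m where m: "0 < m" "\<And>x. x \<in> K \<Longrightarrow> m \<le> s x"
  proof (cases "K = {}")
    case True
    then show ?thesis using that[of 1] by simp
  next
    case False
    have "continuous_on K s"
      using has_C1_gradient_continuous[OF gs] continuous_on_subset by blast
    then obtain x0 where "x0 \<in> K" "\<forall>x\<in>K. s x0 \<le> s x"
      using continuous_attains_inf[OF K False] by blast
    then show ?thesis using that[of "s x0"] s_pos by blast
  qed
  have s_out: "s x = 0" if "x \<notin> (\<Union>c\<in>D. cball c (r c))" for x
  proof -
    have "q (v c x) = 0" if "c \<in> D" for c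
      using v_pos[OF that, of x] q0(1)[of "v c x"] that \<open>x \<notin> (\<Union>c\<in>D. cball c (r c))\<close> by fastforce
    then show ?thesis by (simp add: s_def)
  qed
  define f where "f x = 1 - q (1 - s x / m)" for x
  have "has_C1_gradient (\<lambda>x. 1 - q (1 - s x / m)) (\<lambda>x. (2 * max 0 (1 - s x / m) / m) *\<^sub>R gs x)"
  proof (rule has_C1_gradient_compose[OF gs])
    show "((\<lambda>t. 1 - q (1 - t / m)) has_real_derivative 2 * max 0 (1 - t / m) / m) (at t)" for t
      using m(1) by (auto intro!: derivative_eq_intros DERIV_chain2[OF q])
    show "continuous_on UNIV (\<lambda>t. 2 * max 0 (1 - t / m) / m)"
      using m(1) by (intro continuous_intros) auto
  qed
  moreover have f0: "f x = 0" if "s x = 0" for x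
    using that by (simp add: f_def q_def)
  moreover have "f x \<le> 1" for x
    by (simp add: f_def q0)
  moreover have "0 \<le> f x" for x
  proof -
    have "max 0 (1 - s x / m) \<le> 1"
      using s0[of x] m(1) by simp
    then show ?thesis
      by (simp add: f_def q_def power_le_one)
  qed
  moreover have "f x = 1" if "x \<in> K" for x
    using m(1) m(2)[OF that] q0(1)[of "1 - s x / m"] by (simp add: f_def)
  moreover have "f x = 0" if "x \<notin> U" for x
    using that r(2) D(1) by (intro f0 s_out) blast
  moreover have "bounded {x. f x \<noteq> 0}"
  proof (rule bounded_subset)
    show "bounded (\<Union>c\<in>D. cball c (r c))"
      using D(2) by auto
    show "{x. f x \<noteq> 0} \<subseteq> (\<Union>c\<in>D. cball c (r c))"
      using f0 s_out by blast
  qed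
  ultimately show ?thesis
    using that[of f] by (simp add: f_def[abs_def])
qed

text \<open>This is the duality between finite measures and test functions. Inner regularity of the
  finite measure \<open>|g| d\<mu>\<close> gives compact subsets of \<open>{g > 0}\<close> and \<open>{g < 0}\<close> that carry almost all of its
  mass; a test function equal to 1 on the former and to -1 on the latter almost realises \<open>sgn g\<close>.\<close>

lemma integral_abs_approx_C1:
  fixes \<mu> :: "'a::euclidean_space measure" and g :: "'a \<Rightarrow> real"
  assumes sets_\<mu> [measurable_cong]: "sets \<mu> = sets borel" and g: "integrable \<mu> g" and e: "e > 0"
  obtains f f' where "has_C1_gradient f f'" "\<And>x. \<bar>f x\<bar> \<le> 1" "bounded {x. f x \<noteq> 0}"
    "(LINT x|\<mu>. \<bar>g x\<bar>) - e \<le> (LINT x|\<mu>. f x * g x)"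
proof -
  have [measurable]: "g \<in> borel_measurable \<mu>"
    using g by simp
  define m where "m = density \<mu> (\<lambda>x. ennreal \<bar>g x\<bar>)"
  have sets_m: "sets m = sets borel" and space_m: "space m = UNIV"
    using sets_\<mu> sets_eq_imp_space_eq[OF sets_\<mu>] by (simp_all add: m_def)
  have fin: "emeasure m (space m) \<noteq> \<infinity>"
    using g by (simp add: m_def emeasure_density integrable_iff_bounded space_m cong: nn_integral_cong)
  interpret m: finite_measure m
    using fin by (rule finite_measureI)
  have m_eq: "measure m A = (LINT x|\<mu>. \<bar>g x\<bar> * indicator A x)" if "A \<in> sets borel" for A
  proof -
    have "measure m A = (LINT x|m. indicator A x)"
      using that sets_m by simp
    also have "\<dots> = (LINT x|\<mu>. \<bar>g x\<bar> *\<^sub>R indicator A x)"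
      unfolding m_def using that by (intro integral_density) (auto simp: sets_\<mu>)
    finally show ?thesis by simp
  qed
  have approx: "\<exists>K. compact K \<and> K \<subseteq> A \<and> measure m (A - K) < e / 4" if A: "A \<in> sets borel" for A
  proof -
    have "\<exists>K\<in>{K. K \<subseteq> A \<and> compact K}. emeasure m A < emeasure m K + ennreal (e / 4)"
    proof (rule SUP_approx_ennreal)
      show "emeasure m A = (SUP K\<in>{K. K \<subseteq> A \<and> compact K}. emeasure m K)"
        by (rule inner_regular[OF sets_m fin A])
    qed (use e m.emeasure_finite in \<open>auto simp: less_top[symmetric]\<close>)
    then obtain K where K: "K \<subseteq> A" "compact K" "emeasure m A < emeasure m K + ennreal (e / 4)"
      by blast
    have "ennreal (measure m A) < ennreal (measure m K + e / 4)"
      using K(3) e by (simp add: m.emeasure_eq_measure)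
    then have "measure m A < measure m K + e / 4"
      using e by (simp add: ennreal_less_iff flip: ennreal_plus)
    moreover have "measure m (A - K) = measure m A - measure m K"
      using K A by (intro m.finite_measure_Diff) (auto simp: sets_m borel_compact)
    ultimately show ?thesis
      using K by (intro exI[of _ K]) auto
  qed
  have meas: "{x. g x > 0} \<in> sets borel" "{x. g x < 0} \<in> sets borel"
    using measurable_sets[OF \<open>g \<in> borel_measurable \<mu>\<close>, of "{0<..}"]
      measurable_sets[OF \<open>g \<in> borel_measurable \<mu>\<close>, of "{..<0}"] sets_\<mu> sets_eq_imp_space_eq[OF sets_\<mu>]
    by (auto simp: vimage_def)
  obtain K1 where K1: "compact K1" "K1 \<subseteq> {x. g x > 0}" "measure m ({x. g x > 0} - K1) < e / 4"
    using approx[OF meas(1)] by blast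
  obtain K2 where K2: "compact K2" "K2 \<subseteq> {x. g x < 0}" "measure m ({x. g x < 0} - K2) < e / 4"
    using approx[OF meas(2)] by blast
  have disj: "K1 \<subseteq> - K2" "K2 \<subseteq> - K1"
    using K1(2) K2(2) by force+
  have op: "open (- K1)" "open (- K2)"
    using K1(1) K2(1) by (auto intro: compact_imp_closed)
  obtain f1 g1 where f1: "has_C1_gradient f1 g1" "\<And>x. 0 \<le> f1 x" "\<And>x. f1 x \<le> 1"
    "\<And>x. x \<in> K1 \<Longrightarrow> f1 x = 1" "\<And>x. x \<notin> - K2 \<Longrightarrow> f1 x = 0" "bounded {x. f1 x \<noteq> 0}"
    using C1_Urysohn[OF K1(1) op(2) disj(1)] by blast
  obtain f2 g2 where f2: "has_C1_gradient f2 g2" "\<And>x. 0 \<le> f2 x" "\<And>x. f2 x \<le> 1"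
    "\<And>x. x \<in> K2 \<Longrightarrow> f2 x = 1" "\<And>x. x \<notin> - K1 \<Longrightarrow> f2 x = 0" "bounded {x. f2 x \<noteq> 0}"
    using C1_Urysohn[OF K2(1) op(1) disj(2)] by blast
  define f where "f x = f1 x - f2 x" for x
  have f: "has_C1_gradient f (\<lambda>x. g1 x - g2 x)"
    unfolding f_def[abs_def] by (rule has_C1_gradient_diff[OF f1(1) f2(1)])
  have f_le: "\<bar>f x\<bar> \<le> 1" for x
    using f1(2,3)[of x] f2(2,3)[of x] by (simp add: f_def abs_le_iff)
  have f_bdd: "bounded {x. f x \<noteq> 0}"
    by (rule bounded_subset[OF bounded_Un[THEN iffD2, OF conjI[OF f1(6) f2(6)]]]) (auto simp: f_def)
  have f_meas [measurable]: "f \<in> borel_measurable \<mu>"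
    using borel_measurable_continuous_onI[OF has_C1_gradient_continuous[OF f]] by (simp add: measurable_def sets_\<mu> sets_eq_imp_space_eq[OF sets_\<mu>])
  have fg: "integrable \<mu> (\<lambda>x. f x * g x)"
  proof (rule Bochner_Integration.integrable_bound[OF g])
    show "AE x in \<mu>. norm (f x * g x) \<le> norm (g x)"
      using f_le by (auto simp: abs_mult intro!: mult_left_le_one_le)
  qed measurable
  let ?A = "{x. g x > 0} - K1" and ?B = "{x. g x < 0} - K2"
  have AB: "?A \<in> sets borel" "?B \<in> sets borel"
    using meas borel_compact[OF K1(1)] borel_compact[OF K2(1)] by auto
  have int_ind: "integrable \<mu> (\<lambda>x. \<bar>g x\<bar> * indicator A x)" if "A \<in> sets borel" for A
    using g that sets_\<mu> by (intro integrable_real_mult_indicator) auto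
  have pw: "\<bar>g x\<bar> - f x * g x \<le> 2 * (\<bar>g x\<bar> * indicator ?A x) + 2 * (\<bar>g x\<bar> * indicator ?B x)" for x
  proof -
    have *: "\<bar>g x\<bar> - f x * g x \<le> 2 * \<bar>g x\<bar>"
      using mult_left_le_one_le[OF abs_ge_zero[of "g x"] abs_ge_zero f_le[of x]] by (simp flip: abs_mult)
    consider "x \<in> K1" | "x \<in> K2" | "x \<in> ?A" | "x \<in> ?B" | "g x = 0"
      using linorder_less_linear[of "g x" 0] by blast
    then show ?thesis
    proof cases
      case 1
      then have "f x = 1" "g x > 0"
        using f1(4) f2(5) K1(2) by (auto simp: f_def)
      then show ?thesis by (simp add: indicator_def)
    next
      case 2
      then have "f x = - 1" "g x < 0"
        using f2(4) f1(5) K2(2) by (auto simp: f_def)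
      then show ?thesis by (simp add: indicator_def)
    next
      case 3
      then have "x \<notin> ?B" by auto
      with 3 * show ?thesis by simp
    next
      case 4
      then have "x \<notin> ?A" by auto
      with 4 * show ?thesis by simp
    qed simp
  qed
  have "(LINT x|\<mu>. \<bar>g x\<bar>) - (LINT x|\<mu>. f x * g x) = (LINT x|\<mu>. \<bar>g x\<bar> - f x * g x)"
    using g fg by simp
  also have "\<dots> \<le> (LINT x|\<mu>. 2 * (\<bar>g x\<bar> * indicator ?A x) + 2 * (\<bar>g x\<bar> * indicator ?B x))"
    using g fg int_ind[OF AB(1)] int_ind[OF AB(2)] pw by (intro integral_mono) auto
  also have "\<dots> = 2 * measure m ?A + 2 * measure m ?B"
    using int_ind[OF AB(1)] int_ind[OF AB(2)] by (simp add: m_eq[OF AB(1)] m_eq[OF AB(2)])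
  also have "\<dots> \<le> e"
    using K1(3) K2(3) by simp
  finally show ?thesis
    using that[OF f f_le f_bdd] by simp
qed

section \<open>The directional variation\<close>

lemma BV_is_gradient_measure: "u \<in> BV \<Longrightarrow> is_gradient_measure u (grad u)"
  using someI_ex[of "is_gradient_measure u"] by (auto simp: BV_def grad_def)

lemma BV_gradient:
  fixes u :: "'a::euclidean_space \<Rightarrow> real"
  assumes "u \<in> BV"
  shows finite_total_variation: "finite_measure (total_variation u)"
    and sigma_BV_measurable: "sigma_BV u \<in> borel_measurable borel"
    and sigma_BV_integrable: "integrable (total_variation u) (sigma_BV u)"
    and grad_eq_integral: "E \<in> sets borel \<Longrightarrow> grad u E = (LINT x:E|total_variation u. sigma_BV u x)"
    and norm_grad_le: "E \<in> sets borel \<Longrightarrow> norm (grad u E) \<le> measure (total_variation u) E"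
proof -
  have \<nu>: "vector_measure (grad u)" and fin: "emeasure (variation_measure (grad u)) UNIV < \<infinity>"
    using BV_is_gradient_measure[OF assms] by (auto simp: is_gradient_measure_def)
  show f: "finite_measure (total_variation u)"
    unfolding total_variation_def using fin by (intro finite_measureI) auto
  show "sigma_BV u \<in> borel_measurable borel" "integrable (total_variation u) (sigma_BV u)"
    "E \<in> sets borel \<Longrightarrow> grad u E = (LINT x:E|total_variation u. sigma_BV u x)"
    unfolding total_variation_def sigma_BV_def using polar_density_properties[OF \<nu> fin] by auto
  show "norm (grad u E) \<le> measure (total_variation u) E" if "E \<in> sets borel"
  proof -
    have "ennreal (norm (grad u E)) \<le> ennreal (measure (total_variation u) E)"
      using norm_le_variation[OF that, of "grad u"] emeasure_variation_measure[OF \<nu> that]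
        finite_measure.emeasure_eq_measure[OF f, of E]
      by (simp add: total_variation_def)
    then show ?thesis by simp
  qed
qed

lemma sets_total_variation [simp, measurable_cong]: "sets (total_variation u) = sets borel"
  by (simp add: total_variation_def)

lemma space_total_variation [simp]: "space (total_variation u) = UNIV"
  by (simp add: total_variation_def)

text \<open>For functions of bounded variation the directional variation is finite, and its real value
  is a seminorm in the direction.\<close>

definition dir_var :: "('a::euclidean_space \<Rightarrow> real) \<Rightarrow> 'a \<Rightarrow> real" where
  "dir_var u \<xi> = (LINT x|total_variation u. \<bar>sigma_BV u x \<bullet> \<xi>\<bar>)"

lemma integrable_sigma_BV_inner:
  assumes "u \<in> BV"
  shows "integrable (total_variation u) (\<lambda>x. sigma_BV u x \<bullet> \<xi>)"
  using sigma_BV_integrable[OF assms] by simp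

lemma directional_variation_eq:
  assumes "u \<in> BV"
  shows "directional_variation u \<xi> = ennreal (dir_var u \<xi>)"
  unfolding directional_variation_def dir_var_def
  using integrable_sigma_BV_inner[OF assms, of \<xi>] by (intro nn_integral_eq_integral) auto

lemma dir_var_nonneg: "0 \<le> dir_var u \<xi>"
  by (simp add: dir_var_def)

lemma dir_var_scaleR: "dir_var u (c *\<^sub>R \<xi>) = \<bar>c\<bar> * dir_var u \<xi>"
  by (simp add: dir_var_def abs_mult)

lemma dir_var_triangle:
  assumes "u \<in> BV"
  shows "dir_var u (\<xi> + \<eta>) \<le> dir_var u \<xi> + dir_var u \<eta>"
proof -
  have "dir_var u (\<xi> + \<eta>) \<le> (LINT x|total_variation u. \<bar>sigma_BV u x \<bullet> \<xi>\<bar> + \<bar>sigma_BV u x \<bullet> \<eta>\<bar>)"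
    unfolding dir_var_def using integrable_sigma_BV_inner[OF assms]
    by (intro integral_mono) (auto simp: inner_add_right)
  also have "\<dots> = dir_var u \<xi> + dir_var u \<eta>"
    unfolding dir_var_def using integrable_sigma_BV_inner[OF assms]
    by (intro Bochner_Integration.integral_add) auto
  finally show ?thesis .
qed

text \<open>On the set \<open>P\<close> where \<open>\<sigma> \<bullet> \<xi> \<ge> 0\<close> and on its complement the integrand has a fixed sign, so the
  directional variation is \<open>Du(P) \<bullet> \<xi> - Du(-P) \<bullet> \<xi>\<close>, and \<open>|Du(E)| \<le> |Du|(E)\<close> for each of the two sets.\<close>

lemma dir_var_le:
  fixes u :: "'a::euclidean_space \<Rightarrow> real"
  assumes u: "u \<in> BV"
  shows "dir_var u \<xi> \<le> norm \<xi> * measure (total_variation u) UNIV"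
proof -
  let ?\<mu> = "total_variation u" and ?\<sigma> = "sigma_BV u"
  interpret finite_measure ?\<mu>
    by (rule finite_total_variation[OF u])
  have [measurable]: "?\<sigma> \<in> borel_measurable borel"
    by (rule sigma_BV_measurable[OF u])
  define P where "P = {x. 0 \<le> ?\<sigma> x \<bullet> \<xi>}"
  have P: "P \<in> sets borel"
    unfolding P_def by measurable
  have int: "integrable ?\<mu> (\<lambda>x. indicator E x *\<^sub>R ?\<sigma> x)" if "E \<in> sets borel" for E
    using that sigma_BV_integrable[OF u] by (intro integrable_mult_indicator) auto
  have grad: "grad u E \<bullet> \<xi> = (LINT x|?\<mu>. (indicator E x *\<^sub>R ?\<sigma> x) \<bullet> \<xi>)" if "E \<in> sets borel" for E
    unfolding grad_eq_integral[OF u that] set_lebesgue_integral_def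
    using int[OF that] by (rule integral_inner_left[symmetric])
  have "dir_var u \<xi> = (LINT x|?\<mu>. (indicator P x *\<^sub>R ?\<sigma> x) \<bullet> \<xi> - (indicator (- P) x *\<^sub>R ?\<sigma> x) \<bullet> \<xi>)"
    unfolding dir_var_def
    by (rule Bochner_Integration.integral_cong) (auto simp: P_def indicator_def)
  also have "\<dots> = grad u P \<bullet> \<xi> - grad u (- P) \<bullet> \<xi>"
    unfolding grad[OF P] grad[OF borel_comp[OF P]] using int[OF P] int[OF borel_comp[OF P]]
    by (intro Bochner_Integration.integral_diff integrable_inner_left) auto
  also have "\<dots> \<le> norm (grad u P) * norm \<xi> + norm (grad u (- P)) * norm \<xi>"
    using Cauchy_Schwarz_ineq2[of "grad u P" \<xi>] Cauchy_Schwarz_ineq2[of "grad u (- P)" \<xi>] by linarith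
  also have "\<dots> \<le> measure ?\<mu> P * norm \<xi> + measure ?\<mu> (- P) * norm \<xi>"
    using P by (intro add_mono mult_right_mono norm_grad_le[OF u]) auto
  also have "\<dots> = norm \<xi> * (measure ?\<mu> P + measure ?\<mu> (- P))"
    by (simp add: algebra_simps)
  also have "measure ?\<mu> P + measure ?\<mu> (- P) = measure ?\<mu> UNIV"
    using P finite_measure_Union[of P "- P"] by simp
  finally show ?thesis .
qed

lemma dir_var_Lipschitz:
  assumes "u \<in> BV"
  shows "\<bar>dir_var u \<xi> - dir_var u \<eta>\<bar> \<le> norm (\<xi> - \<eta>) * measure (total_variation u) UNIV"
proof -
  have "dir_var u \<xi> \<le> dir_var u (\<xi> - \<eta>) + dir_var u \<eta>"
    using dir_var_triangle[OF assms, of "\<xi> - \<eta>" \<eta>] by simp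
  moreover have "dir_var u \<eta> \<le> dir_var u (\<eta> - \<xi>) + dir_var u \<xi>"
    using dir_var_triangle[OF assms, of "\<eta> - \<xi>" \<xi>] by simp
  ultimately show ?thesis
    using dir_var_le[OF assms, of "\<xi> - \<eta>"] dir_var_le[OF assms, of "\<eta> - \<xi>"]
    by (simp add: norm_minus_commute abs_le_iff)
qed

lemma continuous_on_dir_var:
  fixes u :: "'a::euclidean_space \<Rightarrow> real"
  assumes "u \<in> BV"
  shows "continuous_on UNIV (dir_var u)"
proof -
  have "(measure (total_variation u) UNIV)-lipschitz_on UNIV (dir_var u)"
    using dir_var_Lipschitz[OF assms] by (intro lipschitz_onI) (auto simp: dist_norm mult.commute)
  then show ?thesis
    by (rule lipschitz_on_continuous_on)
qed

section \<open>Pointwise lower semicontinuity\<close>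

lemma gradient_eq_0_outside_support:
  assumes f: "has_C1_gradient f g" and x: "x \<notin> closure {x. f x \<noteq> 0}"
  shows "g x = 0"
proof -
  have "(f has_derivative (\<lambda>h. 0)) (at x)"
  proof (rule has_derivative_transform_within_open)
    show "((\<lambda>x. 0 :: real) has_derivative (\<lambda>h. 0)) (at x)"
      by simp
    show "open (- closure {x. f x \<noteq> 0})" "x \<in> - closure {x. f x \<noteq> 0}"
      using x by auto
    show "0 = f y" if "y \<in> - closure {x. f x \<noteq> 0}" for y
      using that closure_subset[of "{x. f x \<noteq> 0}"] by auto
  qed
  moreover have "(f has_derivative (\<lambda>h. g x \<bullet> h)) (at x)"
    using f by (simp add: has_C1_gradient_def)
  ultimately have "(\<lambda>h. g x \<bullet> h) = (\<lambda>h. 0)"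
    by (rule has_derivative_unique[symmetric])
  then have "g x \<bullet> g x = 0"
    by meson
  then show ?thesis by simp
qed

lemma BV_directional_integration_by_parts:
  fixes u :: "'a::euclidean_space \<Rightarrow> real"
  assumes u: "u \<in> BV" and f: "has_C1_gradient f g" and bdd: "bounded {x. f x \<noteq> 0}"
  shows "(LINT x|lebesgue. u x * (g x \<bullet> \<xi>)) = - (LINT x|total_variation u. f x * (sigma_BV u x \<bullet> \<xi>))"
proof -
  let ?\<phi> = "\<lambda>x. f x *\<^sub>R \<xi>"
  have der: "(?\<phi> has_derivative (\<lambda>h. (g x \<bullet> h) *\<^sub>R \<xi>)) (at x)" for x
    using f by (intro has_derivative_scaleR_left) (simp add: has_C1_gradient_def)
  have frechet: "frechet_derivative ?\<phi> (at x) = (\<lambda>h. (g x \<bullet> h) *\<^sub>R \<xi>)" for x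
    using frechet_derivative_at[OF der] by simp
  have "compact (closure {x. ?\<phi> x \<noteq> 0})"
    unfolding compact_closure by (rule bounded_subset[OF bdd]) auto
  moreover have "continuous_on UNIV (\<lambda>x. (g x \<bullet> h) *\<^sub>R \<xi>)" for h
    using f by (auto simp: has_C1_gradient_def intro!: continuous_intros)
  ultimately have "?\<phi> \<in> C1_compact_support"
    using der by (auto simp: C1_compact_support_def frechet differentiable_def)
  moreover have "divergence ?\<phi> x = g x \<bullet> \<xi>" for x
    unfolding divergence_def frechet
    by (subst (3) euclidean_inner) (simp add: inner_commute)
  moreover have "(LINT x|lebesgue. u x * divergence ?\<phi> x) = - (LINT x|total_variation u. ?\<phi> x \<bullet> sigma_BV u x)"
    if "?\<phi> \<in> C1_compact_support"
    using BV_is_gradient_measure[OF u] that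
    unfolding is_gradient_measure_def vector_measure_integral_def total_variation_def sigma_BV_def
    by blast
  ultimately show ?thesis
    by (simp add: inner_commute)
qed

lemma integral_mult_C1_tendsto:
  fixes u :: "nat \<Rightarrow> 'a::euclidean_space \<Rightarrow> real"
  assumes u: "\<And>k. integrable lebesgue (u k)" and u0: "integrable lebesgue u0"
    and lim: "\<And>K. compact K \<Longrightarrow> (\<lambda>k. LINT x:K|lebesgue. \<bar>u k x - u0 x\<bar>) \<longlonglongrightarrow> 0"
    and G: "continuous_on UNIV G" and K: "compact K" and supp: "\<And>x. x \<notin> K \<Longrightarrow> G x = 0"
  shows "(\<lambda>k. LINT x|lebesgue. u k x * G x) \<longlonglongrightarrow> (LINT x|lebesgue. u0 x * G x)"
proof -
  have "compact (G ` K)"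
    using G K by (auto intro: compact_continuous_image continuous_on_subset)
  then obtain B0 where B0: "\<And>x. x \<in> K \<Longrightarrow> \<bar>G x\<bar> \<le> B0"
    using compact_imp_bounded bounded_iff by (metis imageI real_norm_def)
  define B where "B = max B0 0"
  have B: "0 \<le> B" "\<bar>G x\<bar> \<le> B * indicator K x" for x
    using B0[of x] supp[of x] by (auto simp: B_def indicator_def)
  have B': "\<bar>G x\<bar> \<le> B" for x
    using B(2)[of x] B(1) by (cases "x \<in> K") auto
  have G_meas [measurable]: "G \<in> borel_measurable lebesgue"
    using borel_measurable_continuous_onI[OF G] by (intro measurable_completion) simp
  have int: "integrable lebesgue (\<lambda>x. w x * G x)" if "integrable lebesgue w" for w
  proof (rule Bochner_Integration.integrable_bound)
    show "integrable lebesgue (\<lambda>x. w x * B)"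
      using that by simp
    show "(\<lambda>x. w x * G x) \<in> borel_measurable lebesgue"
      using that by measurable
    show "AE x in lebesgue. norm (w x * G x) \<le> norm (w x * B)"
      using B' B(1) by (auto simp: abs_mult intro!: mult_left_mono)
  qed
  have K_sets: "K \<in> sets lebesgue"
    using K by (simp add: lmeasurable_compact fmeasurableD)
  have bound: "norm ((LINT x|lebesgue. u k x * G x) - (LINT x|lebesgue. u0 x * G x))
      \<le> B * (LINT x:K|lebesgue. \<bar>u k x - u0 x\<bar>)" for k
  proof -
    have d: "integrable lebesgue (\<lambda>x. u k x - u0 x)"
      using u u0 by simp
    have "(LINT x|lebesgue. u k x * G x) - (LINT x|lebesgue. u0 x * G x) = (LINT x|lebesgue. (u k x - u0 x) * G x)"
      using int[OF u[of k]] int[OF u0] by (simp add: left_diff_distrib)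
    then have "norm ((LINT x|lebesgue. u k x * G x) - (LINT x|lebesgue. u0 x * G x))
        \<le> (LINT x|lebesgue. norm ((u k x - u0 x) * G x))"
      using integral_norm_bound by metis
    also have "\<dots> \<le> (LINT x|lebesgue. B * (indicator K x *\<^sub>R \<bar>u k x - u0 x\<bar>))"
    proof (rule integral_mono)
      show "integrable lebesgue (\<lambda>x. norm ((u k x - u0 x) * G x))"
        using int[OF d] by (rule integrable_norm)
      show "integrable lebesgue (\<lambda>x. B * (indicator K x *\<^sub>R \<bar>u k x - u0 x\<bar>))"
        using d K_sets by (intro integrable_mult_right integrable_mult_indicator) auto
      show "norm ((u k x - u0 x) * G x) \<le> B * (indicator K x *\<^sub>R \<bar>u k x - u0 x\<bar>)" for x
        using mult_left_mono[OF B(2)[of x], of "\<bar>u k x - u0 x\<bar>"] 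
        unfolding real_norm_def abs_mult by (simp add: mult_ac)
    qed
    also have "\<dots> = B * (LINT x:K|lebesgue. \<bar>u k x - u0 x\<bar>)"
      by (simp add: set_lebesgue_integral_def)
    finally show ?thesis .
  qed
  have "(\<lambda>k. (LINT x|lebesgue. u k x * G x) - (LINT x|lebesgue. u0 x * G x)) \<longlonglongrightarrow> 0"
  proof (rule Lim_null_comparison)
    show "(\<lambda>k. B * (LINT x:K|lebesgue. \<bar>u k x - u0 x\<bar>)) \<longlonglongrightarrow> 0"
      using tendsto_mult_right_zero[OF lim[OF K]] .
  qed (use bound in auto)
  then show ?thesis
    by (simp add: LIM_zero_iff)
qed

text \<open>The directional variation is a supremum of the functionals \<open>u \<mapsto> -\<integral> u \<partial>\<^sub>\<xi> f\<close> over test functions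
  bounded by 1, each of which is continuous for local \<open>L\<^sup>1\<close> convergence.\<close>

lemma dir_var_lower_semicontinuous:
  fixes u :: "nat \<Rightarrow> 'a::euclidean_space \<Rightarrow> real"
  assumes u: "\<And>k. u k \<in> BV" and u0: "u0 \<in> BV"
    and lim: "\<And>K. compact K \<Longrightarrow> (\<lambda>k. LINT x:K|lebesgue. \<bar>u k x - u0 x\<bar>) \<longlonglongrightarrow> 0"
    and e: "e > 0"
  shows "\<forall>\<^sub>F k in sequentially. dir_var u0 \<xi> - e < dir_var (u k) \<xi>"
proof -
  obtain f g where f: "has_C1_gradient f g" "\<And>x. \<bar>f x\<bar> \<le> 1" "bounded {x. f x \<noteq> 0}"
    and approx: "dir_var u0 \<xi> - e / 2 \<le> (LINT x|total_variation u0. f x * (sigma_BV u0 x \<bullet> \<xi>))"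
    unfolding dir_var_def
    by (rule integral_abs_approx_C1[OF sets_total_variation integrable_sigma_BV_inner[OF u0], of "e / 2"]) (use e in auto)
  have le: "- (LINT x|lebesgue. u k x * (g x \<bullet> \<xi>)) \<le> dir_var (u k) \<xi>" for k
  proof -
    have "(LINT x|total_variation (u k). f x * (sigma_BV (u k) x \<bullet> \<xi>)) \<le> dir_var (u k) \<xi>"
      unfolding dir_var_def
    proof (rule integral_mono')
      show "f x * (sigma_BV (u k) x \<bullet> \<xi>) \<le> \<bar>sigma_BV (u k) x \<bullet> \<xi>\<bar>" for x
        using mult_left_le_one_le[OF abs_ge_zero[of "sigma_BV (u k) x \<bullet> \<xi>"] abs_ge_zero f(2)[of x]]
        by (simp flip: abs_mult)
    qed (use integrable_sigma_BV_inner[OF u] in auto)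
    then show ?thesis
      using BV_directional_integration_by_parts[OF u f(1,3)] by simp
  qed
  have "(\<lambda>k. LINT x|lebesgue. u k x * (g x \<bullet> \<xi>)) \<longlonglongrightarrow> (LINT x|lebesgue. u0 x * (g x \<bullet> \<xi>))"
  proof (rule integral_mult_C1_tendsto[OF _ _ lim])
    show "integrable lebesgue (u k)" for k
      using u[of k] by (simp add: BV_def)
    show "integrable lebesgue u0"
      using u0 by (simp add: BV_def)
    show "continuous_on UNIV (\<lambda>x. g x \<bullet> \<xi>)"
      using f(1) by (auto simp: has_C1_gradient_def intro!: continuous_intros)
    show "compact (closure {x. f x \<noteq> 0})"
      using f(3) by (simp add: compact_closure)
    show "g x \<bullet> \<xi> = 0" if "x \<notin> closure {x. f x \<noteq> 0}" for x
      using gradient_eq_0_outside_support[OF f(1) that] by simp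
  qed
  then have "(\<lambda>k. - (LINT x|lebesgue. u k x * (g x \<bullet> \<xi>))) \<longlonglongrightarrow> - (LINT x|lebesgue. u0 x * (g x \<bullet> \<xi>))"
    by (rule tendsto_minus)
  moreover have "dir_var u0 \<xi> - e < - (LINT x|lebesgue. u0 x * (g x \<bullet> \<xi>))"
    using approx e BV_directional_integration_by_parts[OF u0 f(1,3)] by simp
  ultimately have "\<forall>\<^sub>F k in sequentially. dir_var u0 \<xi> - e < - (LINT x|lebesgue. u k x * (g x \<bullet> \<xi>))"
    by (rule order_tendstoD(1))
  then show ?thesis
    by (rule eventually_mono) (use le in \<open>blast intro: less_le_trans\<close>)
qed

text \<open>A common Lipschitz constant and a finite net of the sphere turn the pointwise bound
  into a uniform one.\<close>

lemma dir_var_uniformly_lower_semicontinuous: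
  fixes u :: "nat \<Rightarrow> 'a::euclidean_space \<Rightarrow> real"
  assumes u: "\<And>k. u k \<in> BV" and u0: "u0 \<in> BV"
    and lim: "\<And>K. compact K \<Longrightarrow> (\<lambda>k. LINT x:K|lebesgue. \<bar>u k x - u0 x\<bar>) \<longlonglongrightarrow> 0"
    and M: "\<And>k. measure (total_variation (u k)) UNIV \<le> M" and e: "e > 0"
  shows "\<forall>\<^sub>F k in sequentially. \<forall>\<xi>\<in>sphere 0 1. dir_var u0 \<xi> - e \<le> dir_var (u k) \<xi>"
proof -
  define C where "C = max M (measure (total_variation u0) UNIV) + 1"
  have C: "measure (total_variation u0) UNIV \<le> C" "\<And>k. measure (total_variation (u k)) UNIV \<le> C"
    using M by (simp_all add: C_def max.coboundedI1 max.coboundedI2 add_increasing2)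
  have C_pos: "0 < C"
    by (simp add: C_def add_nonneg_pos max.coboundedI2)
  define d where "d = e / (3 * C)"
  have d: "0 < d"
    using e C_pos by (simp add: d_def)
  have sphere: "compact (sphere 0 1 :: 'a set)" by simp
  have cover: "sphere (0::'a) 1 \<subseteq> (\<Union>\<eta>\<in>sphere 0 1. ball \<eta> d)"
    using d by force
  obtain D where D: "D \<subseteq> sphere 0 1" "finite D" "sphere (0::'a) 1 \<subseteq> (\<Union>\<eta>\<in>D. ball \<eta> d)"
    by (rule compactE_image[OF sphere _ cover]) auto
  have "\<forall>\<^sub>F k in sequentially. \<forall>\<eta>\<in>D. dir_var u0 \<eta> - e / 3 < dir_var (u k) \<eta>"
    using D(2) e by (intro eventually_ball_finite ballI dir_var_lower_semicontinuous[OF u u0 lim]) auto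
  then show ?thesis
  proof (rule eventually_mono, intro ballI)
    fix k \<xi> assume k: "\<forall>\<eta>\<in>D. dir_var u0 \<eta> - e / 3 < dir_var (u k) \<eta>" and "\<xi> \<in> sphere (0::'a) 1"
    then obtain \<eta> where \<eta>: "\<eta> \<in> D" "norm (\<xi> - \<eta>) \<le> d"
      using D(3) by (force simp: dist_norm norm_minus_commute)
    have "\<bar>dir_var v \<xi> - dir_var v \<eta>\<bar> \<le> e / 3" if "v \<in> BV" "measure (total_variation v) UNIV \<le> C" for v
    proof -
      have "\<bar>dir_var v \<xi> - dir_var v \<eta>\<bar> \<le> norm (\<xi> - \<eta>) * measure (total_variation v) UNIV"
        by (rule dir_var_Lipschitz[OF that(1)])
      also have "\<dots> \<le> d * C"
        using \<eta>(2) that(2) d by (intro mult_mono) auto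
      finally show ?thesis
        using C_pos by (simp add: d_def)
    qed
    from this[OF u0 C(1)] this[OF u C(2)] k \<eta>(1)
    have "\<bar>dir_var u0 \<xi> - dir_var u0 \<eta>\<bar> \<le> e / 3" "\<bar>dir_var (u k) \<xi> - dir_var (u k) \<eta>\<bar> \<le> e / 3"
      "dir_var u0 \<eta> - e / 3 < dir_var (u k) \<eta>"
      by auto
    then show "dir_var u0 \<xi> - e \<le> dir_var (u k) \<xi>"
      unfolding abs_le_iff by linarith
  qed
qed

section \<open>The integral over the sphere\<close>

lemma sgn_measurable_sphere:
  "sgn \<in> measurable (restrict_space lborel (ball 0 1 - {0})) (restrict_space borel (sphere (0::'a::euclidean_space) 1))"
proof (rule measurable_restrict_space3)
  show "(sgn :: 'a \<Rightarrow> 'a) \<in> borel_measurable lborel"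
    unfolding sgn_div_norm[abs_def] by measurable
  show "sgn \<in> ball 0 1 - {0} \<rightarrow> sphere (0::'a) 1"
    by (auto simp: norm_sgn)
qed

lemma space_sphere_measure: "space (sphere_measure :: 'a::euclidean_space measure) = sphere 0 1"
  by (simp add: sphere_measure_def space_restrict_space space_scale_measure)

lemma measurable_sphere_measure:
  assumes "f \<in> borel_measurable borel"
  shows "f \<in> borel_measurable (sphere_measure :: 'a::euclidean_space measure)"
  using measurable_restrict_space1[OF assms, of "sphere 0 1"]
  by (subst measurable_cong_sets[of _ "restrict_space borel (sphere (0::'a) 1)" _ borel])
     (simp_all add: sphere_measure_def)

lemma nn_integral_sphere_measure:
  assumes "f \<in> borel_measurable borel"
  shows "(\<integral>\<^sup>+\<xi>. f \<xi> \<partial>(sphere_measure :: 'a::euclidean_space measure)) =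
    of_nat DIM('a) * (\<integral>\<^sup>+x. f (sgn x) * indicator (ball 0 1 - {0}) x \<partial>lborel)"
proof -
  have f: "f \<in> borel_measurable (restrict_space borel (sphere (0::'a) 1))"
    by (rule measurable_restrict_space1[OF assms])
  have "(\<integral>\<^sup>+\<xi>. f \<xi> \<partial>(sphere_measure :: 'a measure)) =
      of_nat DIM('a) * (\<integral>\<^sup>+\<xi>. f \<xi> \<partial>distr (restrict_space lborel (ball 0 1 - {0})) (restrict_space borel (sphere (0::'a) 1)) sgn)"
    unfolding sphere_measure_def using f by (intro nn_integral_scale_measure) simp
  also have "\<dots> = of_nat DIM('a) * (\<integral>\<^sup>+x. f (sgn x) \<partial>restrict_space lborel (ball 0 1 - {0}))"
    using f by (subst nn_integral_distr[OF sgn_measurable_sphere]) simp_all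
  also have "\<dots> = of_nat DIM('a) * (\<integral>\<^sup>+x. f (sgn x) * indicator (ball 0 1 - {0}) x \<partial>lborel)"
    by (subst nn_integral_restrict_space) simp_all
  finally show ?thesis .
qed

text \<open>The outer integral of the energy, with value \<open>\<infinity>\<close> exactly when the energy is 0 by convention.\<close>

definition sphere_energy :: "('a::euclidean_space \<Rightarrow> real) \<Rightarrow> ennreal" where
  "sphere_energy u = (\<integral>\<^sup>+\<xi>. inverse (directional_variation u \<xi> ^ DIM('a)) \<partial>sphere_measure)"

lemma affine_BV_energy_eq:
  fixes u :: "'a::euclidean_space \<Rightarrow> real"
  shows "affine_BV_energy u =
    (if sphere_energy u = \<infinity> then 0
     else affine_const DIM('a) * enn2real (sphere_energy u) powr (- 1 / real DIM('a)))"
  by (simp add: affine_BV_energy_def sphere_energy_def Let_def)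

lemma affine_const_nonneg: "1 \<le> n \<Longrightarrow> 0 \<le> affine_const n"
  by (simp add: affine_const_def)

lemma affine_BV_energy_nonneg:
  fixes u :: "'a::euclidean_space \<Rightarrow> real"
  shows "0 \<le> affine_BV_energy u"
  by (simp add: affine_BV_energy_eq affine_const_nonneg DIM_ge_Suc0)

lemma measurable_sphere_energy_integrand:
  fixes u :: "'a::euclidean_space \<Rightarrow> real"
  assumes "u \<in> BV"
  shows "(\<lambda>\<xi>. inverse (directional_variation u \<xi> ^ DIM('a))) \<in> borel_measurable borel"
proof -
  have [measurable]: "dir_var u \<in> borel_measurable borel"
    by (rule borel_measurable_continuous_onI[OF continuous_on_dir_var[OF assms]])
  show ?thesis
    unfolding directional_variation_eq[OF assms] by measurable
qed

lemma ennreal_inverse_antimono: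
  fixes x y :: ennreal
  assumes "x \<le> y"
  shows "inverse y \<le> inverse x"
proof (cases x)
  case (real r)
  show ?thesis
  proof (cases "r = 0")
    case False
    then show ?thesis
      using assms real by (cases y) (auto simp: inverse_ennreal ennreal_le_iff intro!: ennreal_leI le_imp_inverse_le)
  qed (simp add: real)
qed (use assms in \<open>simp add: top_unique\<close>)

lemma inverse_power_ennreal:
  assumes "0 < r"
  shows "inverse (ennreal r ^ n) = ennreal (inverse (r ^ n))"
  using assms by (simp add: ennreal_power inverse_ennreal)

text \<open>As \<open>0 powr r = 0\<close>, a vanishing integral would make the energy 0 where its limiting value is
  infinite. The finiteness of the directional variation excludes this case.\<close>

lemma sphere_energy_pos:
  fixes u :: "'a::euclidean_space \<Rightarrow> real"
  assumes u: "u \<in> BV"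
  shows "0 < sphere_energy u"
proof -
  let ?S = "ball 0 1 - {0} :: 'a set" and ?F = "\<lambda>\<xi>::'a. inverse (directional_variation u \<xi> ^ DIM('a))"
  define M where "M = measure (total_variation u) UNIV + 1"
  have M: "0 < M"
    by (simp add: M_def add_nonneg_pos)
  define a where "a = ennreal (inverse (M ^ DIM('a)))"
  have le: "a * indicator ?S x \<le> ?F (sgn x) * indicator ?S x" for x
  proof (cases "x \<in> ?S")
    case True
    have "dir_var u (sgn x) \<le> M"
      using dir_var_le[OF u, of "sgn x"] True by (simp add: M_def norm_sgn)
    then have "inverse (ennreal M ^ DIM('a)) \<le> ?F (sgn x)"
      unfolding directional_variation_eq[OF u]
      by (intro ennreal_inverse_antimono power_mono ennreal_leI) auto
    then show ?thesis
      using M True by (simp add: a_def inverse_power_ennreal)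
  qed simp
  have "emeasure lborel ?S = emeasure lborel (ball (0::'a) 1)"
    by (rule emeasure_Diff_null_set) auto
  also have "\<dots> > 0"
    by (simp add: emeasure_ball)
  finally have "0 < a * emeasure lborel ?S"
    using M by (simp add: a_def ennreal_zero_less_mult_iff)
  also have "\<dots> = (\<integral>\<^sup>+x. a * indicator ?S x \<partial>lborel)"
    by (rule nn_integral_cmult_indicator[symmetric]) auto
  also have "\<dots> \<le> (\<integral>\<^sup>+x. ?F (sgn x) * indicator ?S x \<partial>lborel)"
    by (rule nn_integral_mono) (rule le)
  finally show ?thesis
    unfolding sphere_energy_def nn_integral_sphere_measure[OF measurable_sphere_energy_integrand[OF u]]
    by (simp add: ennreal_zero_less_mult_iff)
qed

text \<open>If the directional variation vanishes at \<open>\<xi>\<close>, then it is at most \<open>M |x - t \<xi>|\<close> at \<open>x\<close>, for every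
  \<open>t\<close>. Hence each ball of radius \<open>\<delta>\<close> centred on the segment from \<open>\<xi> / 2\<close> to \<open>3 \<xi> / 4\<close> contributes at
  least \<open>(4 M \<delta>)\<^sup>-\<^sup>n\<close> times its volume, a constant that does not depend on \<open>\<delta>\<close>. Arbitrarily many
  disjoint balls of this kind fit along the segment.\<close>

lemma sphere_energy_degenerate:
  fixes u :: "'a::euclidean_space \<Rightarrow> real"
  assumes u: "u \<in> BV" and \<xi>: "norm \<xi> = 1" and zero: "dir_var u \<xi> = 0"
  shows "sphere_energy u = \<infinity>"
proof -
  let ?n = "DIM('a)"
  let ?S = "ball 0 1 - {0} :: 'a set" and ?F = "\<lambda>\<xi>::'a. inverse (directional_variation u \<xi> ^ DIM('a))"
  define X where "X = (\<integral>\<^sup>+x. ?F (sgn x) * indicator ?S x \<partial>lborel)"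
  define M where "M = measure (total_variation u) UNIV + 1"
  have M: "0 < M"
    by (simp add: M_def add_nonneg_pos)
  have le_M: "dir_var u \<eta> \<le> M * norm \<eta>" for \<eta>
    using dir_var_le[OF u, of \<eta>] norm_ge_zero[of \<eta>] unfolding M_def distrib_right mult_1 mult.commute[of "norm \<eta>"]
    by linarith
  define c where "c = unit_ball_vol ?n / (4 * M) ^ ?n"
  have c: "0 < c"
    using M by (simp add: c_def)
  have X_ge: "ennreal (real N * c) \<le> X" if N: "0 < N" for N :: nat
  proof -
    \<comment> \<open>\<open>N\<close> balls with centres \<open>2 \<delta>\<close> apart fill a segment of length \<open>1 / 4\<close>; they stay at distance at least
      \<open>1 / 4\<close> from the origin and inside the unit ball.\<close>
    define \<delta> where "\<delta> = 1 / (8 * real N)"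
    have \<delta>: "0 < \<delta>" "real N * \<delta> = 1 / 8" "\<delta> \<le> 1 / 8"
      using N by (auto simp: \<delta>_def field_simps)
    define t where "t j = 1 / 2 + 2 * \<delta> * real j" for j :: nat
    define B where "B = (\<Union>j<N. ball (t j *\<^sub>R \<xi>) \<delta>)"
    have t: "1 / 2 \<le> t j" "t j \<le> 3 / 4" if "j < N" for j
    proof -
      have "real j * \<delta> \<le> real N * \<delta>"
        using that \<delta>(1) by (intro mult_right_mono) auto
      moreover have "0 \<le> real j * \<delta>"
        using \<delta>(1) by simp
      moreover have "t j = 1 / 2 + 2 * (real j * \<delta>)"
        by (simp add: t_def)
      ultimately show "1 / 2 \<le> t j" "t j \<le> 3 / 4"
        using \<delta>(2) by linarith+
    qed
    have disj: "disjoint_family_on (\<lambda>j. ball (t j *\<^sub>R \<xi>) \<delta>) {..<N}"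
      unfolding disjoint_family_on_def
    proof (intro ballI impI)
      fix i j :: nat assume "i \<noteq> j"
      then have "1 \<le> \<bar>real i - real j\<bar>"
        by linarith
      then have "2 * \<delta> * 1 \<le> 2 * \<delta> * \<bar>real i - real j\<bar>"
        using \<delta>(1) by (intro mult_left_mono) auto
      also have "\<dots> = dist (t i *\<^sub>R \<xi>) (t j *\<^sub>R \<xi>)"
        using \<delta>(1) \<xi> by (simp add: dist_norm t_def abs_mult flip: scaleR_diff_left right_diff_distrib)
      finally show "ball (t i *\<^sub>R \<xi>) \<delta> \<inter> ball (t j *\<^sub>R \<xi>) \<delta> = {}"
        by (intro disjoint_ballI) simp
    qed
    have "emeasure lborel B = (\<Sum>j<N. emeasure lborel (ball (t j *\<^sub>R \<xi>) \<delta>))"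
      unfolding B_def using disj by (intro sum_emeasure[symmetric]) auto
    also have "\<dots> = ennreal (real N * (unit_ball_vol ?n * \<delta> ^ ?n))"
      using \<delta>(1) by (simp add: emeasure_ball ennreal_mult ennreal_of_nat_eq_real_of_nat)
    finally have B: "emeasure lborel B = ennreal (real N * (unit_ball_vol ?n * \<delta> ^ ?n))" .
    define a where "a = inverse ((4 * M * \<delta>) ^ ?n)"
    have le: "ennreal a * indicator B x \<le> ?F (sgn x) * indicator ?S x" for x
    proof (cases "x \<in> B")
      case True
      then obtain j where j: "j < N" "norm (x - t j *\<^sub>R \<xi>) < \<delta>"
        by (auto simp: B_def dist_norm norm_minus_commute)
      have nt: "norm (t j *\<^sub>R \<xi>) = t j"
        using t[OF j(1)] \<xi> by simp
      have x: "1 / 4 \<le> norm x" "norm x < 1"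
        using norm_triangle_ineq2[of "t j *\<^sub>R \<xi>" x] norm_triangle_ineq2[of x "t j *\<^sub>R \<xi>"]
          j(2) t[OF j(1)] \<delta>(3) nt by (auto simp: norm_minus_commute)
      have "dir_var u x \<le> dir_var u (x - t j *\<^sub>R \<xi>) + dir_var u (t j *\<^sub>R \<xi>)"
        using dir_var_triangle[OF u, of "x - t j *\<^sub>R \<xi>" "t j *\<^sub>R \<xi>"] by simp
      also have "\<dots> \<le> M * \<delta>"
        using order_trans[OF le_M mult_left_mono[OF less_imp_le[OF j(2)] less_imp_le[OF M]]]
        by (simp add: dir_var_scaleR zero)
      finally have "dir_var u x \<le> M * \<delta>" .
      then have "dir_var u (sgn x) \<le> inverse (norm x) * (M * \<delta>)"
        by (simp add: sgn_div_norm dir_var_scaleR mult_left_mono)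
      also have "\<dots> \<le> 4 * (M * \<delta>)"
        using le_imp_inverse_le[OF x(1)] M \<delta>(1) by (intro mult_right_mono) auto
      finally have "dir_var u (sgn x) \<le> 4 * M * \<delta>"
        by simp
      then have "inverse (ennreal (4 * M * \<delta>) ^ ?n) \<le> ?F (sgn x)"
        unfolding directional_variation_eq[OF u]
        by (intro ennreal_inverse_antimono power_mono ennreal_leI) auto
      moreover have "x \<in> ?S"
        using x by auto
      ultimately show ?thesis
        using M \<delta>(1) True by (simp add: a_def inverse_power_ennreal)
    qed simp
    have "a * (real N * (unit_ball_vol ?n * \<delta> ^ ?n)) = real N * c"
      using M \<delta>(1) by (simp add: a_def c_def power_mult_distrib field_simps)
    then have "ennreal (real N * c) = ennreal a * emeasure lborel B"
      unfolding B using M \<delta>(1) by (subst ennreal_mult[symmetric]) (auto simp: a_def)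
    also have "\<dots> = (\<integral>\<^sup>+x. ennreal a * indicator B x \<partial>lborel)"
      by (rule nn_integral_cmult_indicator[symmetric]) (auto simp: B_def)
    also have "\<dots> \<le> X"
      unfolding X_def by (rule nn_integral_mono) (rule le)
    finally show ?thesis .
  qed
  have "X = \<infinity>"
  proof (rule ccontr)
    assume "X \<noteq> \<infinity>"
    then obtain r where r: "0 \<le> r" "X = ennreal r"
      by (cases X) auto
    obtain N where N: "r < real N * c"
      using reals_Archimedean3[OF c] by blast
    then have "0 < N"
      using r(1) by (cases N) auto
    then show False
      using X_ge[of N] r N by (simp add: ennreal_le_iff)
  qed
  then show ?thesis
    unfolding sphere_energy_def nn_integral_sphere_measure[OF measurable_sphere_energy_integrand[OF u]]
    by (simp add: X_def[symmetric] ennreal_mult_top)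
qed

section \<open>Lower semicontinuity of the affine energy\<close>

text \<open>The energy is increasing and positively homogeneous of degree one in the directional
  variation. Both properties are used together, to carry a bound up to a factor over to the
  energies.\<close>

lemma affine_BV_energy_mono:
  fixes u v :: "'a::euclidean_space \<Rightarrow> real"
  assumes u: "u \<in> BV" and v: "v \<in> BV" and a: "0 < a"
    and le: "\<And>\<xi>. \<xi> \<in> sphere 0 1 \<Longrightarrow> a * dir_var v \<xi> \<le> dir_var u \<xi>"
  shows "a * affine_BV_energy v \<le> affine_BV_energy u"
proof (cases "sphere_energy v = \<infinity>")
  case True
  then show ?thesis
    using affine_BV_energy_nonneg[of u] by (simp add: affine_BV_energy_eq[of v])
next
  case False
  let ?n = "DIM('a)"
  let ?F = "\<lambda>w \<xi>::'a. inverse (directional_variation w \<xi> ^ ?n)"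
  have pw: "?F u \<xi> \<le> ennreal (inverse (a ^ ?n)) * ?F v \<xi>" if "\<xi> \<in> sphere 0 1" for \<xi>
  proof (cases "dir_var v \<xi> = 0")
    case True
    then show ?thesis
      using a by (simp add: directional_variation_eq[OF v] ennreal_mult_top zero_power)
  next
    case False
    then have pos: "0 < dir_var v \<xi>"
      using dir_var_nonneg[of v \<xi>] by simp
    have "?F u \<xi> \<le> inverse (ennreal (a * dir_var v \<xi>) ^ ?n)"
      unfolding directional_variation_eq[OF u]
      by (intro ennreal_inverse_antimono power_mono ennreal_leI le that) auto
    also have "\<dots> = ennreal (inverse (a ^ ?n)) * ?F v \<xi>"
      unfolding directional_variation_eq[OF v] using a pos
      by (simp add: inverse_power_ennreal power_mult_distrib flip: ennreal_mult)
    finally show ?thesis .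
  qed
  have "sphere_energy u \<le> (\<integral>\<^sup>+\<xi>. ennreal (inverse (a ^ ?n)) * ?F v \<xi> \<partial>sphere_measure)"
    unfolding sphere_energy_def using pw by (intro nn_integral_mono) (auto simp: space_sphere_measure)
  also have "\<dots> = ennreal (inverse (a ^ ?n)) * sphere_energy v"
    unfolding sphere_energy_def
    by (rule nn_integral_cmult[OF measurable_sphere_measure[OF measurable_sphere_energy_integrand[OF v]]])
  finally have le_v: "sphere_energy u \<le> ennreal (inverse (a ^ ?n)) * sphere_energy v" .
  obtain J where J: "0 \<le> J" "sphere_energy v = ennreal J"
    using False by (cases "sphere_energy v") auto
  have "ennreal (inverse (a ^ ?n)) * sphere_energy v = ennreal (inverse (a ^ ?n) * J)"
    using J a by (simp add: ennreal_mult)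
  with le_v have le_J: "sphere_energy u \<le> ennreal (inverse (a ^ ?n) * J)"
    by simp
  then obtain I where I: "0 \<le> I" "sphere_energy u = ennreal I"
    by (cases "sphere_energy u") (auto simp: top_unique)
  have I_pos: "0 < I" and I_le: "I \<le> inverse (a ^ ?n) * J"
    using sphere_energy_pos[OF u] le_J I a J(1) by (simp_all add: ennreal_le_iff)
  have J_pos: "0 < J"
    using sphere_energy_pos[OF v] J by simp
  have "a * J powr (- 1 / real ?n) = (a powr (- real ?n)) powr (- 1 / real ?n) * J powr (- 1 / real ?n)"
    using a by (simp add: powr_powr)
  also have "\<dots> = (inverse (a ^ ?n) * J) powr (- 1 / real ?n)"
    using a J(1) by (simp add: powr_mult powr_minus powr_realpow)
  also have "\<dots> \<le> I powr (- 1 / real ?n)"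
    using I_pos I_le by (intro powr_mono2') auto
  finally have "affine_const ?n * (a * J powr (- 1 / real ?n)) \<le> affine_const ?n * I powr (- 1 / real ?n)"
    by (intro mult_left_mono affine_const_nonneg) (auto simp: DIM_ge_Suc0)
  then show ?thesis
    using I J by (simp add: affine_BV_energy_eq mult_ac)
qed

text \<open>If the energy of \<open>u0\<close> is not 0 by convention, its directional variation has a positive minimum
  \<open>m\<close> on the sphere. A uniform error of \<open>(1 - a) m\<close> then costs at most the factor \<open>a\<close>, and \<open>a\<close> may be
  taken arbitrarily close to 1.\<close>

lemma affine_BV_energy_lower_semicontinuous:
  fixes u :: "nat \<Rightarrow> 'a::euclidean_space \<Rightarrow> real"
  assumes u: "\<And>k. u k \<in> BV" and u0: "u0 \<in> BV"
    and lim: "\<And>K. compact K \<Longrightarrow> (\<lambda>k. LINT x:K|lebesgue. \<bar>u k x - u0 x\<bar>) \<longlonglongrightarrow> 0"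
    and M: "\<And>k. measure (total_variation (u k)) UNIV \<le> M"
  shows "ereal (affine_BV_energy u0) \<le> liminf (\<lambda>k. ereal (affine_BV_energy (u k)))"
proof -
  have nonneg: "0 \<le> liminf (\<lambda>k. ereal (affine_BV_energy (u k)))"
    by (intro Liminf_bounded always_eventually) (simp add: affine_BV_energy_nonneg)
  show ?thesis
  proof (cases "sphere_energy u0 = \<infinity>")
    case True
    then show ?thesis
      using nonneg by (simp add: affine_BV_energy_eq[of u0] flip: zero_ereal_def)
  next
    case False
    have pos: "0 < dir_var u0 \<xi>" if "\<xi> \<in> sphere 0 1" for \<xi>
      using sphere_energy_degenerate[OF u0, of \<xi>] False that dir_var_nonneg[of u0 \<xi>]
      by (auto simp: less_le)
    have "continuous_on (sphere 0 1) (dir_var u0)"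
      using continuous_on_dir_var[OF u0] continuous_on_subset by blast
    then obtain \<xi>0 where \<xi>0: "\<xi>0 \<in> sphere 0 1" "\<And>\<xi>. \<xi> \<in> sphere 0 1 \<Longrightarrow> dir_var u0 \<xi>0 \<le> dir_var u0 \<xi>"
      using continuous_attains_inf[of "sphere (0::'a) 1" "dir_var u0"] by auto
    show ?thesis
    proof (rule ereal_le_mult_one_interval)
      show "liminf (\<lambda>k. ereal (affine_BV_energy (u k))) \<noteq> - \<infinity>"
        using nonneg by auto
      fix z :: ereal assume z: "0 < z" "z < 1"
      then obtain a where a: "z = ereal a" "0 < a" "a < 1"
        by (cases z) auto
      have "\<forall>\<^sub>F k in sequentially. \<forall>\<xi>\<in>sphere 0 1. dir_var u0 \<xi> - (1 - a) * dir_var u0 \<xi>0 \<le> dir_var (u k) \<xi>"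
        using pos[OF \<xi>0(1)] a(3) by (intro dir_var_uniformly_lower_semicontinuous[OF u u0 lim M]) auto
      then have "\<forall>\<^sub>F k in sequentially. a * affine_BV_energy u0 \<le> affine_BV_energy (u k)"
      proof (rule eventually_mono)
        fix k assume k: "\<forall>\<xi>\<in>sphere 0 1. dir_var u0 \<xi> - (1 - a) * dir_var u0 \<xi>0 \<le> dir_var (u k) \<xi>"
        show "a * affine_BV_energy u0 \<le> affine_BV_energy (u k)"
        proof (rule affine_BV_energy_mono[OF u u0 a(2)])
          fix \<xi> :: 'a assume \<xi>: "\<xi> \<in> sphere 0 1"
          have "(1 - a) * dir_var u0 \<xi>0 \<le> (1 - a) * dir_var u0 \<xi>"
            using \<xi>0(2)[OF \<xi>] a(3) by (intro mult_left_mono) auto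
          then show "a * dir_var u0 \<xi> \<le> dir_var (u k) \<xi>"
            using bspec[OF k \<xi>] by (simp add: algebra_simps)
        qed
      qed
      then show "z * ereal (affine_BV_energy u0) \<le> liminf (\<lambda>k. ereal (affine_BV_energy (u k)))"
        unfolding a(1) by (intro Liminf_bounded) (auto elim: eventually_mono)
    qed
  qed
qed

theorem theorem3p2:
  fixes u :: "nat \<Rightarrow> real ^ 'n \<Rightarrow> real" and u0 :: "real ^ 'n \<Rightarrow> real"
  assumes "CARD('n) \<ge> 2"
    and "\<And>k. u k \<in> BV" and "u0 \<in> BV"
    and "\<And>K. compact K \<Longrightarrow> (\<lambda>k. LINT x:K|lebesgue. \<bar>u k x - u0 x\<bar>) \<longlonglongrightarrow> 0"
    and "(SUP k. emeasure (total_variation (u k)) UNIV) < \<infinity>"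
  shows "ereal (affine_BV_energy u0) \<le> liminf (\<lambda>k. ereal (affine_BV_energy (u k)))"
proof (rule affine_BV_energy_lower_semicontinuous[OF assms(2-4)])
  show "measure (total_variation (u k)) UNIV \<le> enn2real (SUP k. emeasure (total_variation (u k)) UNIV)" for k
    unfolding measure_def using assms(5) by (intro enn2real_mono SUP_upper) auto
qed

end
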